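(* Let $N=(N_i)_{i\ge0}$ be a reduced sequence of $(l_i\times l_{i+1})$ nonnegative real matrices with alphabet sequence $\mathcal A=(\mathcal A_i)_{i\ge0}$, $\#\mathcal A_i=l_i>0$, with $(l_i)$ bounded. Then there exists a finite collection $\alpha(i)$, $i=1,2,\dots,d$, of reduced primitive streams, together with a possibly nonproper stream $\mathcal P=(\mathcal P_k)_{k\ge0}$ (the pool stream), such that: (i) $\{\alpha(1),\dots,\alpha(d),\mathcal P\}$ partition $\mathcal A$; after the maximum of the starting times each $\alpha(i)$ is nonempty; (ii) for $i\neq j$, there are front-connections from $\alpha(i)$ to $\alpha(j)$ only if $i<j$; (iii) the pool stream $\mathcal P$ contains no infinite vertex paths; for each $p\in\mathcal P$ there exists a front-connection from $p$ to some stream $\alpha(j)$ with $j>1$ (with no front-connection to $\alpha(1)$), and there exist front-connections from a given stream $\alpha(i)$ to $p\in\mathcal P$ and from $p$ to $\alpha(j)$ only if $i<j$. (iv) This decomposition is unique after some finite time, up to a renumbering of the streams which preserves property (ii). (v) If $\alpha$ is a reduced primitive stream which is maximal in the sense of containment, then there exists a stream decomposition satisfying (i)--(iii) which includes $\alpha$.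
   Context: $N_i$ has rows indexed by $\mathcal A_i$ and columns by $\mathcal A_{i+1}$. A matrix sequence is reduced if no matrix has an all-zero row or an all-zero column. It is primitive if for every $k$ there is $n>k$ such that $N_kN_{k+1}\cdots N_n$ has all entries strictly positive (for sequences starting at time $k_0$, this is required for all $k\ge k_0$). A vertex path is a finite or infinite sequence $(x_kx_{k+1}\dots)$ with $x_i\in\mathcal A_i$ and $(N_n)_{x_nx_{n+1}}>0$ for each consecutive pair. A stream $\alpha=(\alpha_i)_{i\ge0}$ is a sequence of (possibly empty) subsets $\alpha_i\subseteq\mathcal A_i$; set operations and containment are componentwise. It is proper if there is $k\ge0$, its starting time, such that $\alpha_i=\emptyset$ for $i<k$ and $\alpha_i\ne\emptyset$ for $i\ge k$. For a proper stream with starting time $k$, $N^\alpha_i$ ($i\ge k$) is the submatrix of $N_i$ with rows $\alpha_i$ and columns $\alpha_{i+1}$. A proper stream is primitive if $(N_i^\alpha)_{i\ge k}$ is a primitive sequence, and reduced if it is a union of infinite vertex paths from its starting time $k$ on, equivalently $(N_i^\alpha)_{i\ge k}$ is a reduced sequence. A front-connection from a stream $\alpha$ to a stream $\beta$ is a vertex path $x_k,y_{k+1},\dots,y_{n-1},x_n$, $n\ge k+1$, with $x_k\in\alpha_k$, $x_n\in\beta_n$ and $y_i\notin\alpha_i\cup\beta_i$ for $k<i<n$. A single symbol $p\in\mathcal P_k$ is treated as the stream whose only nonempty component is $\{p\}$ at time $k$. In (iv), unique after some finite time means that any two such decompositions agree, up to such a renumbering, for all times beyond some finite time. *)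

theory Defs
  imports Complex_Main
begin

section \<open>Matrix sequences with time-dependent index sets\<close>

text \<open>
  A sequence of matrices starting at time \<open>k0\<close> is given by index sets \<open>B k\<close> and entries
  \<open>M k x y\<close>, where for \<open>k \<ge> k0\<close> the \<open>k\<close>-th matrix has rows \<open>B k\<close> and columns \<open>B (Suc k)\<close>;
  entries outside these index sets are irrelevant. Passing to the submatrices with rows and
  columns in a stream \<open>\<alpha>\<close> therefore means replacing \<open>B\<close> by \<open>\<alpha>\<close> and keeping \<open>M\<close>.
\<close>

definition reduced_seq ::
    "(nat \<Rightarrow> 'a set) \<Rightarrow> (nat \<Rightarrow> 'a \<Rightarrow> 'a \<Rightarrow> real) \<Rightarrow> nat \<Rightarrow> bool" where
  "reduced_seq B M k0 \<longleftrightarrow> (\<forall>k\<ge>k0.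
     (\<forall>x\<in>B k. \<exists>y\<in>B (Suc k). M k x y \<noteq> 0) \<and>
     (\<forall>y\<in>B (Suc k). \<exists>x\<in>B k. M k x y \<noteq> 0))"

text \<open>\<open>mat_prod B M k m\<close> is the product of the \<open>m + 1\<close> matrices at times \<open>k, \<dots>, k + m\<close>.\<close>

primrec mat_prod ::
    "(nat \<Rightarrow> 'a set) \<Rightarrow> (nat \<Rightarrow> 'a \<Rightarrow> 'a \<Rightarrow> real) \<Rightarrow> nat \<Rightarrow> nat \<Rightarrow> 'a \<Rightarrow> 'a \<Rightarrow> real" where
  "mat_prod B M k 0 = M k"
| "mat_prod B M k (Suc m) =
     (\<lambda>x y. \<Sum>z\<in>B (k + Suc m). mat_prod B M k m x z * M (k + Suc m) z y)"

definition primitive_seq ::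
    "(nat \<Rightarrow> 'a set) \<Rightarrow> (nat \<Rightarrow> 'a \<Rightarrow> 'a \<Rightarrow> real) \<Rightarrow> nat \<Rightarrow> bool" where
  "primitive_seq B M k0 \<longleftrightarrow>
     (\<forall>k\<ge>k0. \<exists>n>k. \<forall>x\<in>B k. \<forall>y\<in>B (Suc n). mat_prod B M k (n - k) x y > 0)"

section \<open>Vertex paths\<close>

text \<open>
  Paths are functions on all of \<open>nat\<close>; only the values on \<open>{k..n}\<close> (finite case) or
  \<open>{k..}\<close> (infinite case) matter.
\<close>

definition vertex_path ::
    "(nat \<Rightarrow> 'a set) \<Rightarrow> (nat \<Rightarrow> 'a \<Rightarrow> 'a \<Rightarrow> real) \<Rightarrow> nat \<Rightarrow> nat \<Rightarrow> (nat \<Rightarrow> 'a) \<Rightarrow> bool" where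
  "vertex_path A N k n x \<longleftrightarrow>
     (\<forall>i\<in>{k..n}. x i \<in> A i) \<and> (\<forall>i\<in>{k..<n}. N i (x i) (x (Suc i)) > 0)"

definition infinite_vertex_path ::
    "(nat \<Rightarrow> 'a set) \<Rightarrow> (nat \<Rightarrow> 'a \<Rightarrow> 'a \<Rightarrow> real) \<Rightarrow> nat \<Rightarrow> (nat \<Rightarrow> 'a) \<Rightarrow> bool" where
  "infinite_vertex_path A N k x \<longleftrightarrow>
     (\<forall>i\<ge>k. x i \<in> A i \<and> N i (x i) (x (Suc i)) > 0)"

section \<open>Streams\<close>

type_synonym 'a stream = "nat \<Rightarrow> 'a set"

definition is_stream :: "(nat \<Rightarrow> 'a set) \<Rightarrow> 'a stream \<Rightarrow> bool" where
  "is_stream A \<alpha> \<longleftrightarrow> (\<forall>i. \<alpha> i \<subseteq> A i)"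

definition starts_at :: "'a stream \<Rightarrow> nat \<Rightarrow> bool" where
  "starts_at \<alpha> k \<longleftrightarrow> (\<forall>i<k. \<alpha> i = {}) \<and> (\<forall>i\<ge>k. \<alpha> i \<noteq> {})"

definition proper_stream :: "(nat \<Rightarrow> 'a set) \<Rightarrow> 'a stream \<Rightarrow> bool" where
  "proper_stream A \<alpha> \<longleftrightarrow> is_stream A \<alpha> \<and> (\<exists>k. starts_at \<alpha> k)"

definition start_time :: "'a stream \<Rightarrow> nat" where
  "start_time \<alpha> = (THE k. starts_at \<alpha> k)"

definition primitive_stream ::
    "(nat \<Rightarrow> 'a set) \<Rightarrow> (nat \<Rightarrow> 'a \<Rightarrow> 'a \<Rightarrow> real) \<Rightarrow> 'a stream \<Rightarrow> bool" where
  "primitive_stream A N \<alpha> \<longleftrightarrow> proper_stream A \<alpha> \<and> primitive_seq \<alpha> N (start_time \<alpha>)"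

definition reduced_stream ::
    "(nat \<Rightarrow> 'a set) \<Rightarrow> (nat \<Rightarrow> 'a \<Rightarrow> 'a \<Rightarrow> real) \<Rightarrow> 'a stream \<Rightarrow> bool" where
  "reduced_stream A N \<alpha> \<longleftrightarrow> proper_stream A \<alpha> \<and>
     (\<exists>X. (\<forall>x\<in>X. infinite_vertex_path A N (start_time \<alpha>) x) \<and>
          (\<forall>i\<ge>start_time \<alpha>. \<alpha> i = (\<Union>x\<in>X. {x i})))"

lemma starts_at_unique:
  assumes "starts_at \<alpha> k" "starts_at \<alpha> l"
  shows "k = l"
  using assms unfolding starts_at_def by (metis linorder_neqE_nat order_refl)

lemma starts_at_start_time:
  assumes "proper_stream A \<alpha>"
  shows "starts_at \<alpha> (start_time \<alpha>)"
  using assms unfolding proper_stream_def start_time_def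
  by (metis starts_at_unique theI)

lemma reduced_stream_iff_reduced_seq:
  assumes pr: "proper_stream A \<alpha>"
    and nonneg: "\<And>i x y. x \<in> A i \<Longrightarrow> y \<in> A (Suc i) \<Longrightarrow> N i x y \<ge> 0"
  shows "reduced_stream A N \<alpha> \<longleftrightarrow> reduced_seq \<alpha> N (start_time \<alpha>)"
proof
  define s where "s = start_time \<alpha>"
  assume "reduced_stream A N \<alpha>"
  then obtain X where X: "\<And>x i. x \<in> X \<Longrightarrow> s \<le> i \<Longrightarrow> N i (x i) (x (Suc i)) > 0"
      "\<And>i. s \<le> i \<Longrightarrow> \<alpha> i = (\<Union>x\<in>X. {x i})"
    unfolding reduced_stream_def infinite_vertex_path_def s_def by auto
  show "reduced_seq \<alpha> N (start_time \<alpha>)"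
    unfolding reduced_seq_def s_def[symmetric]
  proof (intro allI impI conjI ballI)
    fix k v assume k: "s \<le> k" and "v \<in> \<alpha> k"
    then obtain x where "x \<in> X" "v = x k" using X(2) by auto
    then show "\<exists>y\<in>\<alpha> (Suc k). N k v y \<noteq> 0"
      using X(1)[of x k] X(2)[of "Suc k"] k by (intro bexI[of _ "x (Suc k)"]) auto
  next
    fix k v assume k: "s \<le> k" and "v \<in> \<alpha> (Suc k)"
    then obtain x where "x \<in> X" "v = x (Suc k)" using X(2)[of "Suc k"] by auto
    then show "\<exists>y\<in>\<alpha> k. N k y v \<noteq> 0"
      using X(1)[of x k] X(2)[of k] k by (intro bexI[of _ "x k"]) auto
  qed
next
  define s where "s = start_time \<alpha>"
  assume red: "reduced_seq \<alpha> N (start_time \<alpha>)"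
  have sub: "\<alpha> i \<subseteq> A i" for i
    using pr unfolding proper_stream_def is_stream_def by simp
  have succ: "\<exists>y\<in>\<alpha> (Suc k). N k x y > 0" if "s \<le> k" "x \<in> \<alpha> k" for k x
    using red that nonneg sub unfolding reduced_seq_def s_def
    by (meson order_le_imp_less_or_eq subsetD dual_order.not_eq_order_implies_strict)
  have pred: "\<exists>x\<in>\<alpha> k. N k x y > 0" if "s \<le> k" "y \<in> \<alpha> (Suc k)" for k y
    using red that nonneg sub unfolding reduced_seq_def s_def
    by (meson order_le_imp_less_or_eq subsetD dual_order.not_eq_order_implies_strict)
  define X where "X = {x. \<forall>i\<ge>s. x i \<in> \<alpha> i \<and> N i (x i) (x (Suc i)) > 0}"
  have tail: "\<exists>x. x (s + m) = v \<and> x \<in> X" if "v \<in> \<alpha> (s + m)" for m v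
  proof -
    have "\<exists>f. \<forall>n. (f n \<in> \<alpha> (s + m + n) \<and> (n = 0 \<longrightarrow> f n = v)) \<and>
            N (s + m + n) (f n) (f (Suc n)) > 0"
    proof (rule dependent_nat_choice)
      show "\<exists>w. w \<in> \<alpha> (s + m + 0) \<and> (0 = (0::nat) \<longrightarrow> w = v)"
        using that by simp
      fix w n
      assume "w \<in> \<alpha> (s + m + n) \<and> (n = 0 \<longrightarrow> w = v)"
      then show "\<exists>y. (y \<in> \<alpha> (s + m + Suc n) \<and> (Suc n = 0 \<longrightarrow> y = v)) \<and> N (s + m + n) w y > 0"
        using succ[of "s + m + n" w] by auto
    qed
    then obtain f where f: "\<And>n. f n \<in> \<alpha> (s + m + n)" "f 0 = v"
        "\<And>n. N (s + m + n) (f n) (f (Suc n)) > 0" by blast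
    define g where "g = (\<lambda>i. f (i - (s + m)))"
    have g: "g i \<in> \<alpha> i" "N i (g i) (g (Suc i)) > 0" if "i \<ge> s + m" for i
      using f(1)[of "i - (s + m)"] f(3)[of "i - (s + m)"] that
      by (simp_all add: g_def Suc_diff_le)
    have "\<exists>x. (\<forall>i\<ge>s + (m - j). x i \<in> \<alpha> i \<and> N i (x i) (x (Suc i)) > 0) \<and> x (s + m) = v"
      if "j \<le> m" for j
      using that
    proof (induction j)
      case 0
      then show ?case using g f(2) by (intro exI[of _ g]) (auto simp: g_def)
    next
      case (Suc j)
      then obtain x where x: "\<And>i. i \<ge> s + (m - j) \<Longrightarrow> x i \<in> \<alpha> i \<and> N i (x i) (x (Suc i)) > 0"
          "x (s + m) = v" by auto
      define k where "k = s + (m - Suc j)"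
      have k: "Suc k = s + (m - j)" "k < s + m" "s \<le> k"
        using Suc.prems by (auto simp: k_def)
      obtain u where "u \<in> \<alpha> k" "N k u (x (Suc k)) > 0"
        using pred[OF k(3)] x(1) k(1) by fastforce
      then have "\<forall>i\<ge>k. (x(k := u)) i \<in> \<alpha> i \<and> N i ((x(k := u)) i) ((x(k := u)) (Suc i)) > 0"
        using x(1) k(1) by (auto simp: not_less_eq_eq)
      moreover have "(x(k := u)) (s + m) = v" using x(2) k(2) by simp
      ultimately show ?case unfolding k_def by blast
    qed
    from this[of m] show ?thesis unfolding X_def by auto
  qed
  have "\<alpha> i = (\<Union>x\<in>X. {x i})" if "i \<ge> s" for i
    using tail[of _ "i - s"] that unfolding X_def by fastforce
  moreover have "\<forall>x\<in>X. infinite_vertex_path A N s x"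
    using sub unfolding X_def infinite_vertex_path_def by blast
  ultimately show "reduced_stream A N \<alpha>"
    using pr unfolding reduced_stream_def s_def by blast
qed

definition maximal_reduced_primitive ::
    "(nat \<Rightarrow> 'a set) \<Rightarrow> (nat \<Rightarrow> 'a \<Rightarrow> 'a \<Rightarrow> real) \<Rightarrow> 'a stream \<Rightarrow> bool" where
  "maximal_reduced_primitive A N \<alpha> \<longleftrightarrow>
     reduced_stream A N \<alpha> \<and> primitive_stream A N \<alpha> \<and>
     (\<forall>\<beta>. reduced_stream A N \<beta> \<and> primitive_stream A N \<beta> \<and> (\<forall>i. \<alpha> i \<subseteq> \<beta> i) \<longrightarrow> \<beta> = \<alpha>)"

section \<open>Front-connections\<close>

definition front_connection ::
    "(nat \<Rightarrow> 'a set) \<Rightarrow> (nat \<Rightarrow> 'a \<Rightarrow> 'a \<Rightarrow> real) \<Rightarrow> 'a stream \<Rightarrow> 'a stream \<Rightarrow>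
     nat \<Rightarrow> nat \<Rightarrow> (nat \<Rightarrow> 'a) \<Rightarrow> bool" where
  "front_connection A N \<alpha> \<beta> k n x \<longleftrightarrow>
     n \<ge> k + 1 \<and> vertex_path A N k n x \<and> x k \<in> \<alpha> k \<and> x n \<in> \<beta> n \<and>
     (\<forall>i. k < i \<and> i < n \<longrightarrow> x i \<notin> \<alpha> i \<union> \<beta> i)"

definition front_connected ::
    "(nat \<Rightarrow> 'a set) \<Rightarrow> (nat \<Rightarrow> 'a \<Rightarrow> 'a \<Rightarrow> real) \<Rightarrow> 'a stream \<Rightarrow> 'a stream \<Rightarrow> bool" where
  "front_connected A N \<alpha> \<beta> \<longleftrightarrow> (\<exists>k n x. front_connection A N \<alpha> \<beta> k n x)"

definition symbol_stream :: "nat \<Rightarrow> 'a \<Rightarrow> 'a stream" where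
  "symbol_stream k p = (\<lambda>i. if i = k then {p} else {})"

section \<open>Stream decompositions\<close>

text \<open>Streams are numbered \<open>\<alpha> 1, \<dots>, \<alpha> d\<close>; other values of \<open>\<alpha>\<close> are irrelevant.\<close>

definition streams_partition ::
    "(nat \<Rightarrow> 'a set) \<Rightarrow> nat \<Rightarrow> (nat \<Rightarrow> 'a stream) \<Rightarrow> 'a stream \<Rightarrow> bool" where
  "streams_partition A d \<alpha> P \<longleftrightarrow>
     (\<forall>k. (\<Union>i\<in>{1..d}. \<alpha> i k) \<union> P k = A k \<and>
          (\<forall>i\<in>{1..d}. \<forall>j\<in>{1..d}. i \<noteq> j \<longrightarrow> \<alpha> i k \<inter> \<alpha> j k = {}) \<and>
          (\<forall>i\<in>{1..d}. \<alpha> i k \<inter> P k = {})) \<and>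
     (\<forall>k \<ge> Max ((\<lambda>i. start_time (\<alpha> i)) ` {1..d}). \<forall>i\<in>{1..d}. \<alpha> i k \<noteq> {})"

definition streams_ordered ::
    "(nat \<Rightarrow> 'a set) \<Rightarrow> (nat \<Rightarrow> 'a \<Rightarrow> 'a \<Rightarrow> real) \<Rightarrow> nat \<Rightarrow> (nat \<Rightarrow> 'a stream) \<Rightarrow> bool" where
  "streams_ordered A N d \<alpha> \<longleftrightarrow>
     (\<forall>i\<in>{1..d}. \<forall>j\<in>{1..d}. i \<noteq> j \<longrightarrow> front_connected A N (\<alpha> i) (\<alpha> j) \<longrightarrow> i < j)"

text \<open>
  In the last clause \<open>i = j\<close> is allowed, so it also excludes front-connections leading from a
  stream through a pool symbol back to the same stream.
\<close>

definition pool_condition ::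
    "(nat \<Rightarrow> 'a set) \<Rightarrow> (nat \<Rightarrow> 'a \<Rightarrow> 'a \<Rightarrow> real) \<Rightarrow> nat \<Rightarrow> (nat \<Rightarrow> 'a stream) \<Rightarrow> 'a stream \<Rightarrow> bool"
  where
  "pool_condition A N d \<alpha> P \<longleftrightarrow>
     (\<nexists>k x. infinite_vertex_path A N k x \<and> (\<forall>i\<ge>k. x i \<in> P i)) \<and>
     (\<forall>k. \<forall>p\<in>P k.
        (\<exists>j\<in>{1..d}. j > 1 \<and> front_connected A N (symbol_stream k p) (\<alpha> j)) \<and>
        \<not> front_connected A N (symbol_stream k p) (\<alpha> 1) \<and>
        (\<forall>i\<in>{1..d}. \<forall>j\<in>{1..d}.
           front_connected A N (\<alpha> i) (symbol_stream k p) \<and>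
           front_connected A N (symbol_stream k p) (\<alpha> j) \<longrightarrow> i < j))"

definition stream_decomposition ::
    "(nat \<Rightarrow> 'a set) \<Rightarrow> (nat \<Rightarrow> 'a \<Rightarrow> 'a \<Rightarrow> real) \<Rightarrow> nat \<Rightarrow> (nat \<Rightarrow> 'a stream) \<Rightarrow> 'a stream \<Rightarrow> bool"
  where
  "stream_decomposition A N d \<alpha> P \<longleftrightarrow>
     (\<forall>i\<in>{1..d}. reduced_stream A N (\<alpha> i) \<and> primitive_stream A N (\<alpha> i)) \<and> is_stream A P \<and>
     streams_partition A d \<alpha> P \<and> streams_ordered A N d \<alpha> \<and> pool_condition A N d \<alpha> P"

definition stream_from :: "nat \<Rightarrow> 'a stream \<Rightarrow> 'a stream" where
  "stream_from K \<alpha> = (\<lambda>k. if k < K then {} else \<alpha> k)"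

text \<open>
  Two decompositions agree after a finite time \<open>K\<close> up to the renumbering \<open>\<sigma>\<close>, where the
  renumbered family still has the ordering property. The ordering property is required from
  time \<open>K\<close> on only: if \<open>a \<rightarrow> a\<close> and \<open>b \<rightarrow> b\<close> at all times and the only further positive entry
  is for \<open>a \<rightarrow> b\<close> at time 0, then the streams \<open>{a}\<close>, \<open>{b}\<close> (in this order) form a decomposition,
  and so do \<open>{a, b}, {b}, {b}, \<dots>\<close> and \<open>{}, {a}, {a}, \<dots>\<close> (in this order); they agree from
  time 1 on after exchanging the numbers, but exchanging the numbers of the first pair
  destroys the ordering property at time 0.
\<close>

definition eventually_same_decomposition ::
    "(nat \<Rightarrow> 'a set) \<Rightarrow> (nat \<Rightarrow> 'a \<Rightarrow> 'a \<Rightarrow> real) \<Rightarrow>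
     nat \<Rightarrow> (nat \<Rightarrow> 'a stream) \<Rightarrow> 'a stream \<Rightarrow> nat \<Rightarrow> (nat \<Rightarrow> 'a stream) \<Rightarrow> 'a stream \<Rightarrow> bool"
  where
  "eventually_same_decomposition A N d \<alpha> P d' \<alpha>' P' \<longleftrightarrow>
     d' = d \<and>
     (\<exists>\<sigma> K. bij_betw \<sigma> {1..d} {1..d} \<and>
        (\<forall>k\<ge>K. (\<forall>i\<in>{1..d}. \<alpha>' i k = \<alpha> (\<sigma> i) k) \<and> P' k = P k) \<and>
        streams_ordered A N d (\<lambda>i. stream_from K (\<alpha> (\<sigma> i))))"

end

theory Submission
  imports Defs
begin

text \<open>
  Positivity of entries and of products only concerns the existence of paths, so the theorem is a
  statement about a layered graph of bounded width. Say that an infinite path \<open>x\<close> leads to an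
  infinite path \<open>y\<close> if at arbitrarily late times \<open>x\<close> has access to a later vertex of \<open>y\<close>. Paths
  that do not both lead to each other are eventually disjoint, so mutual access has at most as many classes
  as the width (\<open>card_inequivalent_paths_le\<close>). The streams of a decomposition are these classes.

  For existence, streams are split off one at a time, sources first. Suppose that the part treated
  so far is closed under predecessors, and let \<open>x\<close> be a path in the rest \<open>B\<close> to which no path of \<open>B\<close>
  from another class leads. Let \<open>T\<close> be the set of vertices of \<open>B\<close> with access to \<open>x\<close>. The vertices
  of \<open>T\<close> reachable from a fixed nonempty level of \<open>T\<close> form a reduced primitive stream: each has
  access to \<open>x\<close>, and \<open>x\<close> has access to all of them at late times, as otherwise Konig's lemma gives
  a path that leads to \<open>x\<close> but is not led to by \<open>x\<close> (\<open>mixing_of_minimal_path\<close>). The other vertices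
  of \<open>T\<close> go to the pool; they carry no infinite path, again by minimality (\<open>split_off_stream\<close>). The
  treated part together with \<open>T\<close> is closed under predecessors, which gives all order conditions
  (\<open>layered_extend\<close>). The streams are disjoint and eventually nonempty, so the width bounds their
  number and the process exhausts the diagram (\<open>layered_completion\<close>).

  Up to any time \<open>K\<close> a reduced primitive stream can absorb all vertices with
  access to its level at time \<open>K\<close>. Hence a maximal one is closed under predecessors
  (\<open>maximal_closed\<close>) and can be the first stream of a decomposition.

  For uniqueness, in any decomposition each stream is convex: a vertex between two of its vertices
  belongs to it. Therefore an infinite path is eventually contained in one stream
  (\<open>path_enters_stream\<close>). Take a path in a stream of one decomposition; it ends up in some stream of
  the other, and by primitivity and convexity so does, at late times, the whole first stream
  (\<open>stream_eventually_in_stream\<close>). By symmetry the two families agree eventually.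
\<close>

section \<open>Paths inside a stream\<close>

text \<open>
  All vertices of the path lie in \<open>B\<close>: with \<open>B = A\<close> this is access in the whole diagram, with
  \<open>B = \<alpha>\<close> it is positivity of the products of the submatrices of \<open>\<alpha>\<close>.
\<close>

inductive reach :: "(nat \<Rightarrow> 'a \<Rightarrow> 'a \<Rightarrow> real) \<Rightarrow> 'a stream \<Rightarrow> nat \<Rightarrow> 'a \<Rightarrow> nat \<Rightarrow> 'a \<Rightarrow> bool"
  for N :: "nat \<Rightarrow> 'a \<Rightarrow> 'a \<Rightarrow> real" and B :: "'a stream" where
  refl: "v \<in> B k \<Longrightarrow> reach N B k v k v"
| step: "reach N B k v n w \<Longrightarrow> u \<in> B (Suc n) \<Longrightarrow> N n w u > 0 \<Longrightarrow> reach N B k v (Suc n) u"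

lemma reach_le: "reach N B k v n w \<Longrightarrow> k \<le> n"
  by (induction rule: reach.induct) auto

lemma reach_source: "reach N B k v n w \<Longrightarrow> v \<in> B k"
  by (induction rule: reach.induct) auto

lemma reach_target: "reach N B k v n w \<Longrightarrow> w \<in> B n"
  by (induction rule: reach.induct) auto

lemma reach_trans:
  assumes "reach N B k v m u" and "reach N B m u n w"
  shows "reach N B k v n w"
  using assms(2,1) by (induction rule: reach.induct) (auto intro: reach.step)

lemma reach_edge:
  assumes "v \<in> B k" "u \<in> B (Suc k)" "N k v u > 0"
  shows "reach N B k v (Suc k) u"
  using assms by (blast intro: reach.intros)

lemma reach_mono:
  assumes "reach N B k v n w" and "\<And>i. k \<le> i \<Longrightarrow> B i \<subseteq> C i"
  shows "reach N C k v n w"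
  using assms
proof (induction rule: reach.induct)
  case (step k v n w u)
  then show ?case using reach_le[OF step.hyps(1)] by (blast intro: reach.step le_SucI)
qed (auto intro: reach.refl)

text \<open>
  The convexity argument: a path of the diagram lies in a stream as soon as the stream contains
  everything between the two ends of the path.
\<close>

lemma reach_restrict:
  assumes "reach N A k v n w"
    and "\<And>i u. reach N A k v i u \<Longrightarrow> reach N A i u n w \<Longrightarrow> u \<in> B i"
  shows "reach N B k v n w"
  using assms
proof (induction rule: reach.induct)
  case (refl v k)
  then show ?case by (blast intro: reach.refl)
next
  case (step k v n w u)
  have "reach N A n w (Suc n) u"
    using step.hyps reach_target by (metis reach_edge)
  then have "reach N B k v n w"
    using step.IH step.prems reach_trans by metis
  moreover have "u \<in> B (Suc n)"
    using step.prems reach.step[OF step.hyps] step.hyps(2) reach.refl by metis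
  ultimately show ?case using step.hyps(3) by (rule reach.step)
qed

lemma reach_last_edge:
  assumes "reach N B k v (Suc n) w" "k \<le> n"
  obtains u where "reach N B k v n u" "N n u w > 0"
  using assms by (cases rule: reach.cases) auto

lemma reach_same_time: "reach N B k v k w \<Longrightarrow> w = v"
  by (cases rule: reach.cases) (auto dest: reach_le)

lemma reach_first_edge:
  assumes "reach N B k v n w" "k < n"
  shows "\<exists>u. N k v u > 0 \<and> reach N B (Suc k) u n w"
  using assms
proof (induction rule: reach.induct)
  case (step k v n w u)
  show ?case
  proof (cases "k < n")
    case True
    then show ?thesis using step by (blast intro: reach.step)
  next
    case False
    then have "n = k" using reach_le[OF step.hyps(1)] by simp
    moreover have "w = v" using step.hyps(1) \<open>n = k\<close> reach_same_time by metis
    ultimately show ?thesis using step.hyps by (blast intro: reach.refl)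
  qed
qed simp

lemma reach_through:
  assumes "reach N B k v n w" "k \<le> m" "m \<le> n"
  shows "\<exists>u. reach N B k v m u \<and> reach N B m u n w"
  using assms
proof (induction rule: reach.induct)
  case (refl v k)
  then show ?case by (auto intro: reach.refl)
next
  case (step k v n w u)
  show ?case
  proof (cases "m = Suc n")
    case True
    then show ?thesis using step.hyps by (blast intro: reach.intros)
  next
    case False
    then have "m \<le> n" using step.prems by simp
    then show ?thesis using step by (blast intro: reach.step)
  qed
qed

lemma reach_along:
  assumes "k \<le> n" "\<And>i. k \<le> i \<Longrightarrow> i \<le> n \<Longrightarrow> x i \<in> B i"
    "\<And>i. k \<le> i \<Longrightarrow> i < n \<Longrightarrow> N i (x i) (x (Suc i)) > 0"
  shows "reach N B k (x k) n (x n)"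
  using assms by (induction n rule: dec_induct) (auto intro: reach.intros)

lemma reach_iff_vertex_path:
  "reach N A k v n w \<longleftrightarrow> k \<le> n \<and> (\<exists>x. vertex_path A N k n x \<and> x k = v \<and> x n = w)"
proof
  assume "reach N A k v n w"
  then show "k \<le> n \<and> (\<exists>x. vertex_path A N k n x \<and> x k = v \<and> x n = w)"
  proof (induction rule: reach.induct)
    case (refl v k)
    then show ?case by (auto simp: vertex_path_def)
  next
    case (step k v n w u)
    then obtain x where x: "k \<le> n" "vertex_path A N k n x" "x k = v" "x n = w" by blast
    have "vertex_path A N k (Suc n) (x(Suc n := u))"
      using x step.hyps unfolding vertex_path_def by (auto simp: le_Suc_eq less_Suc_eq)
    moreover have "(x(Suc n := u)) k = v" "(x(Suc n := u)) (Suc n) = u" using x by auto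
    ultimately show ?case using x(1) le_SucI by blast
  qed
next
  assume "k \<le> n \<and> (\<exists>x. vertex_path A N k n x \<and> x k = v \<and> x n = w)"
  then show "reach N A k v n w"
    unfolding vertex_path_def by (auto intro!: reach_along)
qed

text \<open>
  The condition on the interior of a front-connection costs nothing: cut a path at its last
  visit to \<open>\<alpha>\<close> before the end, and then at the first visit to \<open>\<beta>\<close> after that.
\<close>

lemma front_connected_iff_reach:
  "front_connected A N \<alpha> \<beta> \<longleftrightarrow>
     (\<exists>k n a b. k < n \<and> a \<in> \<alpha> k \<and> b \<in> \<beta> n \<and> reach N A k a n b)"
proof
  assume "front_connected A N \<alpha> \<beta>"
  then obtain k n x where "front_connection A N \<alpha> \<beta> k n x"
    unfolding front_connected_def by blast
  then have "k < n" "x k \<in> \<alpha> k" "x n \<in> \<beta> n" "reach N A k (x k) n (x n)"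
    unfolding front_connection_def reach_iff_vertex_path by auto
  then show "\<exists>k n a b. k < n \<and> a \<in> \<alpha> k \<and> b \<in> \<beta> n \<and> reach N A k a n b" by blast
next
  assume "\<exists>k n a b. k < n \<and> a \<in> \<alpha> k \<and> b \<in> \<beta> n \<and> reach N A k a n b"
  then obtain k n x where kn: "k < n" and x: "vertex_path A N k n x" "x k \<in> \<alpha> k" "x n \<in> \<beta> n"
    unfolding reach_iff_vertex_path by blast
  define k' where "k' = Max {i. k \<le> i \<and> i < n \<and> x i \<in> \<alpha> i}"
  have fin: "finite {i. k \<le> i \<and> i < n \<and> x i \<in> \<alpha> i}" by simp
  have k': "k \<le> k'" "k' < n" "x k' \<in> \<alpha> k'"
    using Max_in[OF fin] kn x(2) unfolding k'_def by blast+
  have lastA: "x i \<notin> \<alpha> i" if "k' < i" "i < n" for i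
    using Max_ge[OF fin, of i] that k' unfolding k'_def[symmetric] by fastforce
  define n' where "n' = (LEAST i. k' < i \<and> x i \<in> \<beta> i)"
  have n': "k' < n'" "x n' \<in> \<beta> n'" "n' \<le> n"
    using LeastI[of "\<lambda>i. k' < i \<and> x i \<in> \<beta> i" n] Least_le[of "\<lambda>i. k' < i \<and> x i \<in> \<beta> i" n] k' x(3)
    unfolding n'_def by auto
  have firstB: "x i \<notin> \<beta> i" if "k' < i" "i < n'" for i
    using not_less_Least[of i "\<lambda>i. k' < i \<and> x i \<in> \<beta> i"] that unfolding n'_def by blast
  have "vertex_path A N k' n' x"
    using x(1) k' n' unfolding vertex_path_def by auto
  then have "front_connection A N \<alpha> \<beta> k' n' x"
    unfolding front_connection_def using k' n' lastA firstB by auto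
  then show "front_connected A N \<alpha> \<beta>" unfolding front_connected_def by blast
qed

lemma mat_prod_pos_iff_reach:
  assumes fin: "\<And>i. finite (B i)"
    and nonneg: "\<And>i x y. x \<in> B i \<Longrightarrow> y \<in> B (Suc i) \<Longrightarrow> M i x y \<ge> 0"
    and x: "x \<in> B k"
  shows "y \<in> B (k + Suc m) \<Longrightarrow> mat_prod B M k m x y \<ge> 0 \<and>
           (mat_prod B M k m x y > 0 \<longleftrightarrow> reach M B k x (k + Suc m) y)"
proof (induction m arbitrary: y)
  case 0
  have "reach M B k x (Suc k) y \<longleftrightarrow> M k x y > 0"
    using reach_edge[of x B k y M] reach_first_edge[of M B k x "Suc k" y] x 0
    by (auto dest: reach_same_time)
  then show ?case using nonneg x 0 by auto
next
  case (Suc m)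
  let ?f = "\<lambda>z. mat_prod B M k m x z * M (k + Suc m) z y"
  have y: "y \<in> B (Suc (k + Suc m))" using Suc.prems by simp
  have nn: "?f z \<ge> 0" if "z \<in> B (k + Suc m)" for z
    using Suc.IH[OF that] nonneg[OF that y] by simp
  have "mat_prod B M k (Suc m) x y > 0 \<longleftrightarrow> (\<exists>z\<in>B (k + Suc m). ?f z > 0)"
  proof -
    have "sum ?f (B (k + Suc m)) = 0 \<longleftrightarrow> (\<forall>z\<in>B (k + Suc m). ?f z = 0)"
      using sum_nonneg_eq_0_iff[OF fin, of "k + Suc m" ?f] nn by blast
    moreover have "sum ?f (B (k + Suc m)) \<ge> 0" using nn by (rule sum_nonneg)
    ultimately show ?thesis using nn by (auto simp: less_le)
  qed
  also have "\<dots> \<longleftrightarrow> (\<exists>z\<in>B (k + Suc m). reach M B k x (k + Suc m) z \<and> M (k + Suc m) z y > 0)"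
  proof (rule bex_cong[OF HOL.refl])
    fix z assume z: "z \<in> B (k + Suc m)"
    show "?f z > 0 \<longleftrightarrow> reach M B k x (k + Suc m) z \<and> M (k + Suc m) z y > 0"
      using Suc.IH[OF z] nonneg[OF z y] by (auto simp: zero_less_mult_iff)
  qed
  also have "\<dots> \<longleftrightarrow> reach M B k x (Suc (k + Suc m)) y"
    using y reach_last_edge[of M B k x "k + Suc m" y] reach_target[of M B k x "k + Suc m"]
      reach.step[of M B k x "k + Suc m" _ y] by (metis le_add1)
  finally show ?case using nn by (simp add: sum_nonneg)
qed

text \<open>
  Konig's lemma for levels linked backwards. Every level can be traced back to the first one,
  which is finite, so one vertex there has descendants at all later levels; and a vertex with this
  property has a successor with this property, because it has finitely many successors.
\<close>

lemma konig_path: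
  fixes N :: "nat \<Rightarrow> 'a \<Rightarrow> 'a \<Rightarrow> real"
  assumes fin: "\<And>k. finite (D k)"
    and ne: "\<And>k. k \<ge> k0 \<Longrightarrow> D k \<noteq> {}"
    and pred: "\<And>k v. k \<ge> k0 \<Longrightarrow> v \<in> D (Suc k) \<Longrightarrow> \<exists>u\<in>D k. N k u v > 0"
  shows "\<exists>x. \<forall>i\<ge>k0. x i \<in> D i \<and> N i (x i) (x (Suc i)) > 0"
proof -
  define good where "good k v \<longleftrightarrow> (\<forall>n\<ge>k. \<exists>w. reach N D k v n w)" for k v
  have extend: "\<exists>v\<in>F. good k v" if F: "finite F" and deep: "\<And>n. n \<ge> k \<Longrightarrow> \<exists>v\<in>F. \<exists>w. reach N D k v n w" for F k
  proof (rule ccontr)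
    assume "\<not> ?thesis"
    then have "\<forall>v\<in>F. \<exists>n. n \<ge> k \<and> \<not> (\<exists>w. reach N D k v n w)" unfolding good_def by blast
    then obtain h where h: "\<And>v. v \<in> F \<Longrightarrow> h v \<ge> k \<and> \<not> (\<exists>w. reach N D k v (h v) w)" by metis
    define n where "n = Max (insert k (h ` F))"
    have n: "n \<ge> k" "\<And>v. v \<in> F \<Longrightarrow> h v \<le> n" using F unfolding n_def by auto
    obtain v w where "v \<in> F" "reach N D k v n w" using deep[OF n(1)] by blast
    then show False using reach_through[of N D k v n w "h v"] h n by blast
  qed
  have "\<exists>v\<in>D k0. \<exists>w. reach N D k0 v n w" if "n \<ge> k0" for n
  proof -
    have "\<exists>v. reach N D k0 v n w" if "w \<in> D n" for w
      using \<open>n \<ge> k0\<close> that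
    proof (induction n arbitrary: w rule: dec_induct)
      case base
      then show ?case by (blast intro: reach.refl)
    next
      case (step n)
      then obtain u where "u \<in> D n" "N n u w > 0" using pred by blast
      then show ?case using step by (blast intro: reach.step)
    qed
    then show ?thesis using ne[OF that] by (meson all_not_in_conv reach_source)
  qed
  then have start: "\<exists>v. good k0 v" using extend[OF fin] by blast
  have next': "\<exists>u. good (Suc k) u \<and> N k v u > 0" if "good k v" for k v
  proof -
    have "\<exists>u\<in>{u\<in>D (Suc k). N k v u > 0}. \<exists>w. reach N D (Suc k) u n w" if "n \<ge> Suc k" for n
      using \<open>good k v\<close> that reach_first_edge[of N D k v n] unfolding good_def
      by (auto dest: reach_source) (meson Suc_le_lessD less_imp_le reach_source)
    then show ?thesis using extend[of "{u\<in>D (Suc k). N k v u > 0}" "Suc k"] fin by auto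
  qed
  have "\<exists>f. \<forall>n. good (k0 + n) (f n) \<and> N (k0 + n) (f n) (f (Suc n)) > 0"
    by (rule dependent_nat_choice) (use start next' in auto)
  then obtain f where f: "\<And>n. good (k0 + n) (f n)" "\<And>n. N (k0 + n) (f n) (f (Suc n)) > 0" by blast
  have "f (i - k0) \<in> D i \<and> N i (f (i - k0)) (f (Suc i - k0)) > 0" if "i \<ge> k0" for i
    using f[of "i - k0"] that unfolding good_def by (auto simp: Suc_diff_le dest: reach_source)
  then show ?thesis by (intro exI[of _ "\<lambda>i. f (i - k0)"]) blast
qed

lemma path_of_successors:
  assumes "v \<in> D k" and "\<And>i u. i \<ge> k \<Longrightarrow> u \<in> D i \<Longrightarrow> \<exists>w\<in>D (Suc i). N i u w > 0"
  shows "\<exists>x. x k = v \<and> (\<forall>i\<ge>k. x i \<in> D i \<and> N i (x i) (x (Suc i)) > 0)"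
proof -
  have "\<exists>f. \<forall>n. (f n \<in> D (k + n) \<and> (n = 0 \<longrightarrow> f n = v)) \<and> N (k + n) (f n) (f (Suc n)) > 0"
  proof (rule dependent_nat_choice)
    fix u n assume "u \<in> D (k + n) \<and> (n = 0 \<longrightarrow> u = v)"
    then show "\<exists>w. (w \<in> D (k + Suc n) \<and> (Suc n = 0 \<longrightarrow> w = v)) \<and> N (k + n) u w > 0"
      using assms(2)[of "k + n" u] by auto
  qed (use assms(1) in auto)
  then obtain f where f: "\<And>n. f n \<in> D (k + n)" "f 0 = v" "\<And>n. N (k + n) (f n) (f (Suc n)) > 0" 
    by blast
  have "f (i - k) \<in> D i \<and> N i (f (i - k)) (f (Suc i - k)) > 0" if "i \<ge> k" for i
    using f(1)[of "i - k"] f(3)[of "i - k"] that by (simp add: Suc_diff_le)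
  then show ?thesis using f(2) by (intro exI[of _ "\<lambda>i. f (i - k)"]) simp
qed

section \<open>Infinite paths up to mutual access\<close>

text \<open>
  The starting time is left open, since the classes of paths under mutual access depend on tails
  only.
\<close>

definition tail_path :: "(nat \<Rightarrow> 'a \<Rightarrow> 'a \<Rightarrow> real) \<Rightarrow> 'a stream \<Rightarrow> (nat \<Rightarrow> 'a) \<Rightarrow> bool" where
  "tail_path N B x \<longleftrightarrow> (\<exists>k. \<forall>i\<ge>k. x i \<in> B i \<and> N i (x i) (x (Suc i)) > 0)"

definition leads :: "(nat \<Rightarrow> 'a \<Rightarrow> 'a \<Rightarrow> real) \<Rightarrow> 'a stream \<Rightarrow> (nat \<Rightarrow> 'a) \<Rightarrow> (nat \<Rightarrow> 'a) \<Rightarrow> bool" where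
  "leads N A x y \<longleftrightarrow> (\<forall>m. \<exists>i\<ge>m. \<exists>j. reach N A i (x i) j (y j))"

lemma leads_trans:
  assumes y: "tail_path N A y" and xy: "leads N A x y" and yz: "leads N A y z"
  shows "leads N A x z"
  unfolding leads_def
proof
  fix m
  obtain k where k: "\<And>i. i \<ge> k \<Longrightarrow> y i \<in> A i \<and> N i (y i) (y (Suc i)) > 0"
    using y unfolding tail_path_def by blast
  obtain i j where ij: "i \<ge> max m k" "reach N A i (x i) j (y j)" using xy unfolding leads_def by blast
  obtain i' j' where ij': "i' \<ge> j" "reach N A i' (y i') j' (z j')" using yz unfolding leads_def by blast
  have "j \<ge> k" using ij reach_le[OF ij(2)] by simp
  then have "reach N A j (y j) i' (y i')" using k ij' by (intro reach_along) auto
  then show "\<exists>i\<ge>m. \<exists>j. reach N A i (x i) j (z j)"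
    using ij ij' by (meson max.boundedE reach_trans)
qed

text \<open>
  Pairwise inequivalent paths are eventually disjoint, since two paths that meet infinitely
  often lead to each other. Hence the width of the diagram bounds the number of classes.
\<close>

lemma card_inequivalent_paths_le:
  assumes finA: "\<And>i. finite (A i)" and card: "\<And>i. card (A i) \<le> L" and Q: "finite Q"
    and paths: "\<And>x. x \<in> Q \<Longrightarrow> tail_path N A x"
    and ineq: "\<And>x y. x \<in> Q \<Longrightarrow> y \<in> Q \<Longrightarrow> x \<noteq> y \<Longrightarrow> \<not> (leads N A x y \<and> leads N A y x)"
  shows "card Q \<le> L"
proof -
  have in_A: "\<forall>\<^sub>F i in sequentially. x i \<in> A i" if "x \<in> Q" for x
    using paths[OF that] unfolding tail_path_def eventually_sequentially by blast
  have apart: "\<forall>\<^sub>F i in sequentially. x i \<noteq> y i" if "x \<in> Q" "y \<in> Q" "x \<noteq> y" for x y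
  proof (rule ccontr)
    assume "\<not> ?thesis"
    then have "\<exists>\<^sub>F i in sequentially. x i = y i" by (simp add: frequently_def)
    then have "\<exists>\<^sub>F i in sequentially. x i \<in> A i \<and> x i = y i"
      by (rule frequently_rev_mp) (use in_A[OF that(1)] in \<open>auto elim: eventually_mono\<close>)
    then have meet: "\<And>m. \<exists>i\<ge>m. x i \<in> A i \<and> x i = y i" by (simp add: frequently_sequentially)
    then have "leads N A x y \<and> leads N A y x"
      unfolding leads_def by (metis reach.refl)
    then show False using ineq that by blast
  qed
  have "\<forall>\<^sub>F i in sequentially. \<forall>x\<in>Q. x i \<in> A i \<and> (\<forall>y\<in>Q. x \<noteq> y \<longrightarrow> x i \<noteq> y i)"
    using Q in_A apart by (simp add: eventually_ball_finite_distrib eventually_conj_iff)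
  then obtain i where i: "\<And>x. x \<in> Q \<Longrightarrow> x i \<in> A i"
      "\<And>x y. x \<in> Q \<Longrightarrow> y \<in> Q \<Longrightarrow> x \<noteq> y \<Longrightarrow> x i \<noteq> y i"
    unfolding eventually_sequentially by blast
  have "card Q \<le> card (A i)"
    by (rule card_inj_on_le[of "\<lambda>x. x i"]) (use i finA in \<open>auto simp: inj_on_def\<close>)
  then show ?thesis using card order_trans by blast
qed

text \<open>
  Choose pairwise inequivalent paths in \<open>B\<close>, as many as possible. They represent all classes, so
  a minimal one among these finitely many is minimal among all paths in \<open>B\<close>.
\<close>

lemma minimal_path_exists:
  assumes finA: "\<And>i. finite (A i)" and card: "\<And>i. card (A i) \<le> L"
    and BA: "is_stream A B" and ne: "tail_path N B x0"
  shows "\<exists>x. tail_path N B x \<and> (\<forall>y. tail_path N B y \<longrightarrow> leads N A y x \<longrightarrow> leads N A x y)"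
proof -
  have pathA: "tail_path N A x" if "tail_path N B x" for x
    using that BA unfolding tail_path_def is_stream_def by blast
  define indep where "indep Q \<longleftrightarrow> finite Q \<and> (\<forall>x\<in>Q. tail_path N B x) \<and>
      (\<forall>x\<in>Q. \<forall>y\<in>Q. x \<noteq> y \<longrightarrow> \<not> (leads N A x y \<and> leads N A y x))" for Q
  have bound: "card Q \<le> L" if "indep Q" for Q
  proof (rule card_inequivalent_paths_le[of A, OF finA card, of Q N])
    show "finite Q" "\<And>x. x \<in> Q \<Longrightarrow> tail_path N A x"
      using that pathA unfolding indep_def by blast+
    show "\<not> (leads N A x y \<and> leads N A y x)" if "x \<in> Q" "y \<in> Q" "x \<noteq> y" for x y
      using \<open>indep Q\<close> that unfolding indep_def by blast
  qed
  have "indep {x0}" using ne unfolding indep_def by simp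
  then have "\<exists>Q. indep Q \<and> (\<forall>R. indep R \<longrightarrow> card R \<le> card Q)"
    by (rule ex_has_greatest_nat[where b = "Suc L"]) (simp add: bound less_Suc_eq_le)
  then obtain Q where Q: "indep Q" and max: "\<And>R. indep R \<Longrightarrow> card R \<le> card Q" by metis
  have "Q \<noteq> {}" using max[OF \<open>indep {x0}\<close>] by auto
  have path: "tail_path N B q" if "q \<in> Q" for q using that Q unfolding indep_def by blast
  define R where "R x y \<longleftrightarrow> leads N A x y \<and> \<not> leads N A y x" for x y
  have "transp_on Q R"
    unfolding R_def transp_on_def using leads_trans[of N A] path pathA by blast
  moreover have "asymp_on Q R" unfolding R_def by (auto intro: asymp_onI)
  ultimately obtain q where q: "q \<in> Q" "\<And>x. x \<in> Q \<Longrightarrow> x \<noteq> q \<Longrightarrow> \<not> R x q"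
    using Finite_Set.bex_min_element[of Q R] Q \<open>Q \<noteq> {}\<close> unfolding indep_def by blast
  have "leads N A q y" if y: "tail_path N B y" and yq: "leads N A y q" for y
  proof -
    \<comment> \<open>The maximal family meets every class.\<close>
    have "\<exists>r\<in>Q. leads N A r y \<and> leads N A y r"
    proof (rule ccontr)
      assume no: "\<not> ?thesis"
      moreover have "leads N A q y" if "y \<in> Q"
        using q(2)[OF that] yq unfolding R_def by (cases "y = q") auto
      ultimately have "y \<notin> Q" using yq q(1) by blast
      moreover have "indep (insert y Q)" using Q y no unfolding indep_def by blast
      moreover have "finite Q" using Q unfolding indep_def by blast
      ultimately have "Suc (card Q) \<le> card Q" using max[of "insert y Q"] by simp
      then show False by simp
    qed
    then obtain r where r: "r \<in> Q" "leads N A r y" "leads N A y r" by blast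
    have rq: "leads N A r q" using leads_trans[OF pathA[OF y] r(2) yq] .
    have "leads N A q r"
    proof (cases "r = q")
      case False
      then show ?thesis using q(2)[OF r(1)] rq unfolding R_def by blast
    qed (use rq in simp)
    then show ?thesis using leads_trans[OF pathA[OF path[OF r(1)]]] r(2) by blast
  qed
  then show ?thesis using path[OF q(1)] by blast
qed

section \<open>Reduced primitive streams\<close>

locale reduced_diagram =
  fixes A :: "nat \<Rightarrow> 'a set" and N :: "nat \<Rightarrow> 'a \<Rightarrow> 'a \<Rightarrow> real" and L :: nat
  assumes finite_A: "finite (A k)"
    and card_A: "card (A k) \<le> L"
    and nonempty_A: "A k \<noteq> {}"
    and nonneg: "x \<in> A k \<Longrightarrow> y \<in> A (Suc k) \<Longrightarrow> N k x y \<ge> 0"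
    and succ_A: "x \<in> A k \<Longrightarrow> \<exists>y\<in>A (Suc k). N k x y > 0"
    and pred_A: "y \<in> A (Suc k) \<Longrightarrow> \<exists>x\<in>A k. N k x y > 0"
begin

text \<open>
  Reducedness and primitivity in terms of paths. In a reduced stream full connectedness from time
  \<open>k\<close> to one later time persists at all times after it, by following predecessors.
\<close>

definition mixing :: "'a stream \<Rightarrow> nat \<Rightarrow> bool" where
  "mixing \<alpha> s \<longleftrightarrow> is_stream A \<alpha> \<and> starts_at \<alpha> s \<and>
     (\<forall>k\<ge>s. \<forall>x\<in>\<alpha> k. \<exists>y\<in>\<alpha> (Suc k). N k x y > 0) \<and>
     (\<forall>k\<ge>s. \<forall>y\<in>\<alpha> (Suc k). \<exists>x\<in>\<alpha> k. N k x y > 0) \<and>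
     (\<forall>k\<ge>s. \<exists>m. \<forall>n\<ge>m. \<forall>x\<in>\<alpha> k. \<forall>y\<in>\<alpha> n. reach N \<alpha> k x n y)"

lemma reduced_primitive_iff_mixing:
  "reduced_stream A N \<alpha> \<and> primitive_stream A N \<alpha> \<longleftrightarrow> (\<exists>s. mixing \<alpha> s)"
proof
  assume rp: "reduced_stream A N \<alpha> \<and> primitive_stream A N \<alpha>"
  define s where "s = start_time \<alpha>"
  have pr: "proper_stream A \<alpha>" using rp unfolding reduced_stream_def by blast
  then have sub: "is_stream A \<alpha>" and start: "starts_at \<alpha> s"
    using starts_at_start_time[OF pr] unfolding proper_stream_def s_def by auto
  have sub': "\<alpha> i \<subseteq> A i" for i using sub unfolding is_stream_def by blast
  have "reduced_seq \<alpha> N s"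
    using rp reduced_stream_iff_reduced_seq[OF pr, of N] nonneg unfolding s_def by blast
  then have succ: "\<exists>y\<in>\<alpha> (Suc k). N k x y > 0" if "k \<ge> s" "x \<in> \<alpha> k" for k x
    using that nonneg sub' unfolding reduced_seq_def by (metis less_eq_real_def subsetD)
  have pred: "\<exists>x\<in>\<alpha> k. N k x y > 0" if "k \<ge> s" "y \<in> \<alpha> (Suc k)" for k y
    using that nonneg sub' \<open>reduced_seq \<alpha> N s\<close> unfolding reduced_seq_def
    by (metis less_eq_real_def subsetD)
  have fin: "finite (\<alpha> i)" for i using finite_A sub' finite_subset by metis
  have mat_prod: "mat_prod \<alpha> N k m x y > 0 \<longleftrightarrow> reach N \<alpha> k x (k + Suc m) y"
    if "x \<in> \<alpha> k" "y \<in> \<alpha> (k + Suc m)" for k m x y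
    using mat_prod_pos_iff_reach[of \<alpha> N x k y m] fin nonneg sub' that by blast
  have "\<exists>m. \<forall>n\<ge>m. \<forall>x\<in>\<alpha> k. \<forall>y\<in>\<alpha> n. reach N \<alpha> k x n y" if k: "k \<ge> s" for k
  proof -
    obtain n where n: "n > k" "\<And>x y. x \<in> \<alpha> k \<Longrightarrow> y \<in> \<alpha> (Suc n) \<Longrightarrow> mat_prod \<alpha> N k (n - k) x y > 0"
      using rp k unfolding primitive_stream_def primitive_seq_def s_def by blast
    have full: "reach N \<alpha> k x (Suc n) y" if "x \<in> \<alpha> k" "y \<in> \<alpha> (Suc n)" for x y
    proof -
      have "k + Suc (n - k) = Suc n" using n by simp
      then show ?thesis using mat_prod[OF that(1), of y "n - k"] that n(2) by simp
    qed
    have "\<forall>x\<in>\<alpha> k. \<forall>y\<in>\<alpha> n'. reach N \<alpha> k x n' y" if "n' \<ge> Suc n" for n'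
      using that
    proof (induction n' rule: dec_induct)
      case base
      then show ?case using full by blast
    next
      case (step n')
      then have "s \<le> n'" using n(1) k by simp
      then show ?case using step.IH pred by (meson reach.step)
    qed
    then show ?thesis by blast
  qed
  then have "mixing \<alpha> s" unfolding mixing_def using sub start succ pred by blast
  then show "\<exists>s. mixing \<alpha> s" ..
next
  assume "\<exists>s. mixing \<alpha> s"
  then obtain s where m: "mixing \<alpha> s" ..
  have sub: "is_stream A \<alpha>" and start: "starts_at \<alpha> s"
    and succ: "\<And>k x. k \<ge> s \<Longrightarrow> x \<in> \<alpha> k \<Longrightarrow> \<exists>y\<in>\<alpha> (Suc k). N k x y > 0"
    and pred: "\<And>k y. k \<ge> s \<Longrightarrow> y \<in> \<alpha> (Suc k) \<Longrightarrow> \<exists>x\<in>\<alpha> k. N k x y > 0"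
    and full: "\<And>k. k \<ge> s \<Longrightarrow> \<exists>m. \<forall>n\<ge>m. \<forall>x\<in>\<alpha> k. \<forall>y\<in>\<alpha> n. reach N \<alpha> k x n y"
    using m unfolding mixing_def by auto
  have pr: "proper_stream A \<alpha>" using sub start unfolding proper_stream_def by blast
  have s: "start_time \<alpha> = s" using starts_at_unique[OF starts_at_start_time[OF pr] start] .
  have sub': "\<alpha> i \<subseteq> A i" for i using sub unfolding is_stream_def by blast
  have fin: "finite (\<alpha> i)" for i using finite_A sub' finite_subset by metis
  have mat_prod: "mat_prod \<alpha> N k m x y > 0 \<longleftrightarrow> reach N \<alpha> k x (k + Suc m) y"
    if "x \<in> \<alpha> k" "y \<in> \<alpha> (k + Suc m)" for k m x y
    using mat_prod_pos_iff_reach[of \<alpha> N x k y m] fin nonneg sub' that by blast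
  have "reduced_seq \<alpha> N s"
    unfolding reduced_seq_def using succ pred by (metis less_irrefl)
  then have red: "reduced_stream A N \<alpha>"
    using reduced_stream_iff_reduced_seq[OF pr, of N] nonneg s by blast
  have "\<exists>n>k. \<forall>x\<in>\<alpha> k. \<forall>y\<in>\<alpha> (Suc n). mat_prod \<alpha> N k (n - k) x y > 0" if "k \<ge> s" for k
  proof -
    obtain m where m: "\<And>n x y. n \<ge> m \<Longrightarrow> x \<in> \<alpha> k \<Longrightarrow> y \<in> \<alpha> n \<Longrightarrow> reach N \<alpha> k x n y"
      using full[OF \<open>k \<ge> s\<close>] by metis
    define n where "n = max m (Suc k)"
    have n: "n > k" "n \<ge> m" "k + Suc (n - k) = Suc n" unfolding n_def by auto
    have "mat_prod \<alpha> N k (n - k) x y > 0" if "x \<in> \<alpha> k" "y \<in> \<alpha> (Suc n)" for x y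
      using mat_prod[OF that(1), of y "n - k"] that n m[of "Suc n" x y] by simp
    then show ?thesis using n(1) by blast
  qed
  then have "primitive_seq \<alpha> N (start_time \<alpha>)" unfolding primitive_seq_def s by blast
  then show "reduced_stream A N \<alpha> \<and> primitive_stream A N \<alpha>"
    using red pr unfolding primitive_stream_def by blast
qed

lemma mixing_subset: "mixing \<alpha> s \<Longrightarrow> \<alpha> k \<subseteq> A k"
  unfolding mixing_def is_stream_def by blast

lemma mixing_nonempty: "mixing \<alpha> s \<Longrightarrow> k \<ge> s \<Longrightarrow> \<alpha> k \<noteq> {}"
  unfolding mixing_def starts_at_def by blast

lemma mixing_start: "mixing \<alpha> s \<Longrightarrow> v \<in> \<alpha> k \<Longrightarrow> k \<ge> s"
  unfolding mixing_def starts_at_def by (metis empty_iff not_le)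

lemma mixing_reach:
  assumes "mixing \<alpha> s" "k \<ge> s"
  shows "\<exists>m. \<forall>n\<ge>m. \<forall>x\<in>\<alpha> k. \<forall>y\<in>\<alpha> n. reach N A k x n y"
  using assms reach_mono[of N \<alpha> k _ _ _ A] mixing_subset unfolding mixing_def by metis

lemma mixing_path:
  assumes "mixing \<alpha> s"
  shows "\<exists>x. \<forall>i\<ge>s. x i \<in> \<alpha> i \<and> N i (x i) (x (Suc i)) > 0"
proof -
  obtain v where "v \<in> \<alpha> s" using mixing_nonempty[OF assms] by blast
  then show ?thesis
    using path_of_successors[of v \<alpha> s N] assms unfolding mixing_def by blast
qed

lemma ancestor_exists:
  assumes "v \<in> A n" "k \<le> n"
  shows "\<exists>u. reach N A k u n v"
  using assms(2,1)
proof (induction n arbitrary: v rule: dec_induct)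
  case base
  then show ?case by (blast intro: reach.refl)
next
  case (step n)
  then show ?case using pred_A by (meson reach.step)
qed

lemma reach_in_closed:
  assumes "reach N A k v n w" "v \<in> B k"
    and closed: "\<And>k v u. v \<in> B k \<Longrightarrow> u \<in> A (Suc k) \<Longrightarrow> N k v u > 0 \<Longrightarrow> u \<in> B (Suc k)"
  shows "w \<in> B n"
  using assms(1,2) by (induction rule: reach.induct) (auto intro: closed)

text \<open>
  What can fail for the vertices between \<open>Y\<close> and \<open>x\<close> is that \<open>x\<close> does not find its way back to
  some of them. At infinitely many times this would give, by Konig's lemma, a path leading to
  \<open>x\<close> without \<open>x\<close> leading to it, against minimality.
\<close>

lemma mixing_of_minimal_path:
  assumes closed: "\<And>k v u. v \<in> B k \<Longrightarrow> u \<in> A (Suc k) \<Longrightarrow> N k v u > 0 \<Longrightarrow> u \<in> B (Suc k)"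
    and x: "\<And>i. i \<ge> k0 \<Longrightarrow> x i \<in> A i \<and> N i (x i) (x (Suc i)) > 0"
    and minimal: "\<And>y. tail_path N B y \<Longrightarrow> leads N A y x \<Longrightarrow> leads N A x y"
    and Y: "Y \<subseteq> B s" "Y \<noteq> {}" "\<And>v. v \<in> Y \<Longrightarrow> \<exists>n\<ge>k0. reach N A s v n (x n)"
  defines "\<alpha> \<equiv> \<lambda>k. {v. (\<exists>y\<in>Y. reach N A s y k v) \<and> (\<exists>n\<ge>k0. reach N A k v n (x n))}"
  shows "mixing \<alpha> s"
proof -
  have along: "reach N A i (x i) j (x j)" if "k0 \<le> i" "i \<le> j" for i j
    using that x by (intro reach_along) auto
  have later: "\<exists>n\<ge>m. reach N A k v n (x n)" if "reach N A k v n (x n)" "n \<ge> k0" for k v n m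
    using reach_trans[OF that(1) along[of n "max n m"]] that(2) by (intro exI[of _ "max n m"]) auto
  have sub: "\<alpha> k \<subseteq> A k" for k unfolding \<alpha>_def by (auto dest: reach_source)
  have subB: "\<alpha> k \<subseteq> B k" for k
    unfolding \<alpha>_def using Y(1) reach_in_closed[of s _ k _ B] closed by blast
  have "\<alpha> k \<noteq> {}" if k: "k \<ge> s" for k
  proof -
    obtain y n where y: "y \<in> Y" "n \<ge> k0" "n \<ge> k" "reach N A s y n (x n)"
      using Y(2,3) later[of s _ _ "max k k0"] by fastforce
    then show ?thesis using reach_through[OF y(4) k] unfolding \<alpha>_def by blast
  qed
  moreover have "\<alpha> k = {}" if "k < s" for k
    unfolding \<alpha>_def using that by (auto dest: reach_le)
  ultimately have start: "starts_at \<alpha> s" unfolding starts_at_def by blast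
  have succ: "\<exists>u\<in>\<alpha> (Suc k). N k v u > 0" if v: "v \<in> \<alpha> k" for k v
  proof -
    obtain y n where y: "y \<in> Y" "reach N A s y k v" "n \<ge> max k0 (Suc k)" "reach N A k v n (x n)"
      using v later[of k v _ "max k0 (Suc k)"] unfolding \<alpha>_def by blast
    then obtain u where u: "N k v u > 0" "reach N A (Suc k) u n (x n)"
      using reach_first_edge[OF y(4)] by auto
    then have "reach N A s y (Suc k) u" using y(2) by (blast intro: reach.step dest: reach_source)
    then show ?thesis using u y unfolding \<alpha>_def by auto
  qed
  have pred: "\<exists>u\<in>\<alpha> k. N k u v > 0" if v: "v \<in> \<alpha> (Suc k)" and k: "k \<ge> s" for k v
  proof -
    obtain y n where y: "y \<in> Y" "reach N A s y (Suc k) v" "n \<ge> k0" "reach N A (Suc k) v n (x n)"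
      using v unfolding \<alpha>_def by blast
    obtain u where u: "reach N A s y k u" "N k u v > 0" using y(2) k by (rule reach_last_edge)
    have "reach N A k u (Suc k) v"
      using reach_edge[of u A k v N] reach_target[OF u(1)] reach_source[OF y(4)] u(2) by blast
    then have "reach N A k u n (x n)" using y(4) by (rule reach_trans)
    then show ?thesis using u y(1,3) unfolding \<alpha>_def by blast
  qed
  have fin: "finite (\<alpha> k)" for k using finite_A sub finite_subset by metis
  have mix: "\<exists>m. \<forall>n\<ge>m. \<forall>v\<in>\<alpha> k. \<forall>w\<in>\<alpha> n. reach N \<alpha> k v n w" if "k \<ge> s" for k
  proof -
    have "\<forall>v\<in>\<alpha> k. \<exists>n. n \<ge> k0 \<and> reach N A k v n (x n)" unfolding \<alpha>_def by blast
    then obtain h where h: "\<And>v. v \<in> \<alpha> k \<Longrightarrow> h v \<ge> k0 \<and> reach N A k v (h v) (x (h v))"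
      by metis
    define n where "n = Max (insert k0 (h ` \<alpha> k))"
    have n0: "n \<ge> k0" and nh: "\<And>v. v \<in> \<alpha> k \<Longrightarrow> h v \<le> n" using fin unfolding n_def by auto
    have to_x: "reach N A k v n (x n)" if "v \<in> \<alpha> k" for v
      using h[OF that] nh[OF that] along reach_trans by metis
    define D where "D j = {w\<in>\<alpha> j. \<not> reach N A n (x n) j w}" for j
    define r where "r = max n s"
    have predD: "\<exists>u\<in>D j. N j u v > 0" if v: "v \<in> D (Suc j)" and j: "j \<ge> r" for j v
    proof -
      obtain u where u: "u \<in> \<alpha> j" "N j u v > 0"
        using pred[of v j] v j unfolding D_def r_def by auto
      moreover have "\<not> reach N A n (x n) j u"
        using v u sub reach.step[of N A n "x n" j u v] unfolding D_def by blast
      ultimately show ?thesis unfolding D_def by blast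
    qed
    have "\<exists>j\<ge>r. D j = {}"
    proof (rule ccontr)
      assume "\<not> ?thesis"
      moreover have "finite (D j)" for j using fin unfolding D_def by simp
      ultimately obtain y where y: "\<And>i. i \<ge> r \<Longrightarrow> y i \<in> D i \<and> N i (y i) (y (Suc i)) > 0"
        using konig_path[of D r N] predD by blast
      have "tail_path N B y" using y subB unfolding tail_path_def D_def by blast
      moreover have "leads N A y x"
        unfolding leads_def
      proof
        fix m
        have "y (max m r) \<in> \<alpha> (max m r)" using y unfolding D_def by simp
        then show "\<exists>i\<ge>m. \<exists>j. reach N A i (y i) j (x j)"
          unfolding \<alpha>_def by (intro exI[of _ "max m r"]) auto
      qed
      ultimately have "leads N A x y" by (rule minimal)
      then obtain i j where ij: "i \<ge> r" "reach N A i (x i) j (y j)" unfolding leads_def by blast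
      then have "reach N A n (x n) j (y j)"
        using along[of n i] n0 reach_trans unfolding r_def by fastforce
      moreover have "j \<ge> r" using ij reach_le by fastforce
      ultimately show False using y unfolding D_def by blast
    qed
    then obtain m where m: "m \<ge> r" "D m = {}" by blast
    \<comment> \<open>Vertices out of reach of \<open>x n\<close> have predecessors out of reach, so one empty level suffices.\<close>
    have D_empty: "D j = {}" if "j \<ge> m" for j
      using that
    proof (induction j rule: dec_induct)
      case (step j)
      then show ?case using predD m(1) by fastforce
    qed (fact m(2))
    have "reach N \<alpha> k v j w" if j: "j \<ge> m" and v: "v \<in> \<alpha> k" and w: "w \<in> \<alpha> j" for j v w
    proof (rule reach_restrict)
      show "reach N A k v j w"
        using to_x[OF v] D_empty[OF j] w reach_trans unfolding D_def by fastforce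
      show "u \<in> \<alpha> i" if "reach N A k v i u" "reach N A i u j w" for i u
        using v w that unfolding \<alpha>_def by (auto intro: reach_trans)
    qed
    then show ?thesis by blast
  qed
  show ?thesis
    unfolding mixing_def is_stream_def using sub start succ pred mix by blast
qed

text \<open>
  The successor-closed stream \<open>B\<close> is what remains after some streams have been removed, and \<open>T\<close>
  is the part of \<open>B\<close> that has access to a minimal path. The vertices of \<open>T\<close> outside \<open>\<alpha>\<close> go to
  the pool. Starting with the whole first nonempty level of \<open>T\<close>, as the last two conclusions say,
  ensures that for \<open>B = A\<close> nothing is left for the pool.
\<close>

lemma split_off_stream:
  assumes B: "is_stream A B" "B k1 \<noteq> {}"
    and closed: "\<And>k v u. v \<in> B k \<Longrightarrow> u \<in> A (Suc k) \<Longrightarrow> N k v u > 0 \<Longrightarrow> u \<in> B (Suc k)"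
  obtains \<alpha> s T where "mixing \<alpha> s" "\<And>k. \<alpha> k \<subseteq> T k" "\<And>k. T k \<subseteq> B k"
    "\<And>k v n w. v \<in> B k \<Longrightarrow> reach N A k v n w \<Longrightarrow> w \<in> T n \<Longrightarrow> v \<in> T k"
    "\<And>k a m p n b. a \<in> \<alpha> k \<Longrightarrow> reach N A k a m p \<Longrightarrow> reach N A m p n b \<Longrightarrow> b \<in> \<alpha> n \<Longrightarrow> p \<in> \<alpha> m"
    "\<And>y. \<not> tail_path N (\<lambda>k. T k - \<alpha> k) y"
    "\<And>k. k < s \<Longrightarrow> T k = {}" "\<And>k v u. u \<in> T s \<Longrightarrow> reach N A s u k v \<Longrightarrow> v \<in> T k \<Longrightarrow> v \<in> \<alpha> k"
proof -
  obtain v1 where v1: "v1 \<in> B k1" using B(2) by blast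
  have BA: "B k \<subseteq> A k" for k using B(1) unfolding is_stream_def by blast
  obtain x1 where "\<forall>i\<ge>k1. x1 i \<in> B i \<and> N i (x1 i) (x1 (Suc i)) > 0"
    using path_of_successors[of v1 B k1 N] v1 succ_A closed BA by (meson subsetD)
  then have "tail_path N B x1" unfolding tail_path_def by blast
  then obtain x where "tail_path N B x"
    and minimal: "\<And>y. tail_path N B y \<Longrightarrow> leads N A y x \<Longrightarrow> leads N A x y"
    using minimal_path_exists[of A L B N x1] finite_A card_A B(1) by blast
  then obtain k0 where xB: "\<And>i. i \<ge> k0 \<Longrightarrow> x i \<in> B i \<and> N i (x i) (x (Suc i)) > 0"
    unfolding tail_path_def by blast
  have along: "reach N A i (x i) j (x j)" if "k0 \<le> i" "i \<le> j" for i j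
    using that xB BA by (intro reach_along) (auto intro: subsetD[OF BA])
  define T where "T k = {v\<in>B k. \<exists>n\<ge>k0. reach N A k v n (x n)}" for k
  have "x k0 \<in> T k0" using xB along[of k0 k0] unfolding T_def by blast
  then have ex: "\<exists>k. T k \<noteq> {}" by blast
  define s where "s = (LEAST k. T k \<noteq> {})"
  have s: "T s \<noteq> {}" "\<And>k. k < s \<Longrightarrow> T k = {}"
    using LeastI_ex[OF ex] not_less_Least unfolding s_def by blast+
  define \<alpha> where "\<alpha> = (\<lambda>k. {v. (\<exists>y\<in>T s. reach N A s y k v) \<and> (\<exists>n\<ge>k0. reach N A k v n (x n))})"
  have mix: "mixing \<alpha> s"
    unfolding \<alpha>_def
  proof (rule mixing_of_minimal_path[of B, OF closed])
    show "x i \<in> A i \<and> N i (x i) (x (Suc i)) > 0" if "i \<ge> k0" for i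
      using xB[OF that] BA by blast
    show "T s \<noteq> {}" using s(1) .
    show "T s \<subseteq> B s" "\<And>v. v \<in> T s \<Longrightarrow> \<exists>n\<ge>k0. reach N A s v n (x n)"
      unfolding T_def by blast+
  qed (use minimal in blast)+
  have sub: "\<alpha> k \<subseteq> T k" for k
    unfolding \<alpha>_def T_def using reach_in_closed[of s _ k _ B] closed by blast
  show thesis
  proof (rule that[OF mix sub])
    show "T k \<subseteq> B k" for k unfolding T_def by blast
    show "v \<in> T k" if v: "v \<in> B k" and vw: "reach N A k v n w" and w: "w \<in> T n" for k v n w
    proof -
      obtain j where "j \<ge> k0" "reach N A n w j (x j)" using w unfolding T_def by blast
      then show ?thesis using reach_trans[OF vw] v unfolding T_def by blast
    qed
    show "p \<in> \<alpha> m" if a: "a \<in> \<alpha> k" and ap: "reach N A k a m p" and pb: "reach N A m p n b"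
        and b: "b \<in> \<alpha> n" for k a m p n b
    proof -
      obtain y where y: "y \<in> T s" "reach N A s y k a" using a unfolding \<alpha>_def by blast
      obtain j where j: "j \<ge> k0" "reach N A n b j (x j)" using b unfolding \<alpha>_def by blast
      show ?thesis using reach_trans[OF y(2) ap] reach_trans[OF pb j(2)] y(1) j(1)
        unfolding \<alpha>_def by blast
    qed
    show "T k = {}" if "k < s" for k using s(2) that .
    show "v \<in> \<alpha> k" if "u \<in> T s" "reach N A s u k v" "v \<in> T k" for k v u
      using that unfolding \<alpha>_def T_def by blast
    show "\<not> tail_path N (\<lambda>k. T k - \<alpha> k) y" for y
    proof
      assume "tail_path N (\<lambda>k. T k - \<alpha> k) y"
      then obtain k2 where y: "\<And>i. i \<ge> k2 \<Longrightarrow> y i \<in> T i - \<alpha> i \<and> N i (y i) (y (Suc i)) > 0"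
        unfolding tail_path_def by blast
      have "tail_path N B y" using y unfolding tail_path_def T_def by blast
      moreover have "leads N A y x"
        unfolding leads_def
      proof
        fix m
        have "y (max m k2) \<in> T (max m k2)" using y by simp
        then show "\<exists>i\<ge>m. \<exists>j. reach N A i (y i) j (x j)"
          unfolding T_def by (intro exI[of _ "max m k2"]) auto
      qed
      ultimately have xy: "leads N A x y" by (rule minimal)
      obtain u n where u: "u \<in> T s" "n \<ge> k0" "reach N A s u n (x n)"
        using s(1) unfolding T_def by blast
      obtain i j where ij: "i \<ge> max n k2" "reach N A i (x i) j (y j)"
        using xy unfolding leads_def by blast
      have "reach N A s u j (y j)"
        using u ij along[of n i] by (meson max.boundedE reach_trans)
      moreover have "j \<ge> k2" using ij reach_le by fastforce
      ultimately show False using y u(1) unfolding \<alpha>_def T_def by blast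
    qed
  qed
qed

section \<open>Layered families of streams\<close>

text \<open>
  The part \<open>V\<close> of the diagram already decomposed is closed under predecessors, so nothing chosen
  later reaches it; the pool so far is \<open>V\<close> minus the streams. For \<open>V = A\<close> this is the notion of
  a stream decomposition, see \<open>decomposition_iff_layered\<close>.
\<close>

definition layered :: "nat \<Rightarrow> (nat \<Rightarrow> 'a stream) \<Rightarrow> 'a stream \<Rightarrow> bool" where
  "layered d \<alpha> V \<longleftrightarrow>
     (\<forall>k. V k \<subseteq> A k) \<and>
     (\<forall>k v n w. reach N A k v n w \<longrightarrow> w \<in> V n \<longrightarrow> v \<in> V k) \<and>
     (\<forall>i\<in>{1..d}. \<exists>s. mixing (\<alpha> i) s) \<and>
     (\<forall>i\<in>{1..d}. \<forall>k. \<alpha> i k \<subseteq> V k) \<and>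
     (\<forall>i\<in>{1..d}. \<forall>j\<in>{1..d}. i \<noteq> j \<longrightarrow> (\<forall>k. \<alpha> i k \<inter> \<alpha> j k = {})) \<and>
     (\<forall>i\<in>{1..d}. \<forall>j\<in>{1..d}. \<forall>k a n b.
        a \<in> \<alpha> i k \<longrightarrow> b \<in> \<alpha> j n \<longrightarrow> reach N A k a n b \<longrightarrow> i \<le> j) \<and>
     (\<forall>i\<in>{1..d}. \<forall>k a m p n b. a \<in> \<alpha> i k \<longrightarrow> reach N A k a m p \<longrightarrow>
        reach N A m p n b \<longrightarrow> b \<in> \<alpha> i n \<longrightarrow> p \<in> \<alpha> i m) \<and>
     (\<forall>y. \<not> tail_path N (\<lambda>k. V k - (\<Union>i\<in>{1..d}. \<alpha> i k)) y) \<and>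
     (\<forall>k p n b. reach N A k p n b \<longrightarrow> b \<in> \<alpha> 1 n \<longrightarrow> p \<in> \<alpha> 1 k)"

context
  fixes d \<alpha> V
  assumes lay: "layered d \<alpha> V"
begin

lemma layered_subset: "V k \<subseteq> A k"
  using lay unfolding layered_def by (elim conjE) blast

lemma layered_closed: "reach N A k v n w \<Longrightarrow> w \<in> V n \<Longrightarrow> v \<in> V k"
  using lay unfolding layered_def by (elim conjE) blast

lemma layered_mixing: "i \<in> {1..d} \<Longrightarrow> \<exists>s. mixing (\<alpha> i) s"
  using lay unfolding layered_def by (elim conjE) blast

lemma layered_stream_subset: "i \<in> {1..d} \<Longrightarrow> \<alpha> i k \<subseteq> V k"
  using lay unfolding layered_def by (elim conjE) blast

lemma layered_disjoint:
  "i \<in> {1..d} \<Longrightarrow> j \<in> {1..d} \<Longrightarrow> v \<in> \<alpha> i k \<Longrightarrow> v \<in> \<alpha> j k \<Longrightarrow> i = j"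
  using lay unfolding layered_def by (elim conjE) blast

lemma layered_ordered:
  "i \<in> {1..d} \<Longrightarrow> j \<in> {1..d} \<Longrightarrow> a \<in> \<alpha> i k \<Longrightarrow> b \<in> \<alpha> j n \<Longrightarrow> reach N A k a n b \<Longrightarrow> i \<le> j"
  using lay unfolding layered_def by (elim conjE) blast

lemma layered_convex:
  "i \<in> {1..d} \<Longrightarrow> a \<in> \<alpha> i k \<Longrightarrow> reach N A k a m p \<Longrightarrow> reach N A m p n b \<Longrightarrow> b \<in> \<alpha> i n \<Longrightarrow> p \<in> \<alpha> i m"
  by (rule lay[unfolded layered_def, THEN conjunct2, THEN conjunct2, THEN conjunct2,
        THEN conjunct2, THEN conjunct2, THEN conjunct2, THEN conjunct1, rule_format])

lemma layered_pool: "\<not> tail_path N (\<lambda>k. V k - (\<Union>i\<in>{1..d}. \<alpha> i k)) y"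
  by (rule lay[unfolded layered_def, THEN conjunct2, THEN conjunct2, THEN conjunct2,
        THEN conjunct2, THEN conjunct2, THEN conjunct2, THEN conjunct2, THEN conjunct1, rule_format])

lemma layered_first: "reach N A k p n b \<Longrightarrow> b \<in> \<alpha> 1 n \<Longrightarrow> p \<in> \<alpha> 1 k"
  by (rule lay[unfolded layered_def, THEN conjunct2, THEN conjunct2, THEN conjunct2,
        THEN conjunct2, THEN conjunct2, THEN conjunct2, THEN conjunct2, THEN conjunct2, rule_format])

lemma layered_eventually_nonempty: "\<exists>K. \<forall>k\<ge>K. \<forall>i\<in>{1..d}. \<alpha> i k \<noteq> {}"
proof -
  have "\<forall>\<^sub>F k in sequentially. \<alpha> i k \<noteq> {}" if "i \<in> {1..d}" for i
    using layered_mixing[OF that] mixing_nonempty unfolding eventually_sequentially by blast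
  then have "\<forall>\<^sub>F k in sequentially. \<forall>i\<in>{1..d}. \<alpha> i k \<noteq> {}"
    by (simp add: eventually_ball_finite)
  then show ?thesis unfolding eventually_sequentially .
qed

text \<open>
  At a late time all streams are nonempty and disjoint inside one alphabet.
\<close>

lemma layered_number_le: "d \<le> L"
proof -
  obtain k where k: "\<And>i. i \<in> {1..d} \<Longrightarrow> \<alpha> i k \<noteq> {}" using layered_eventually_nonempty by blast
  define f where "f i = (SOME v. v \<in> \<alpha> i k)" for i
  have f: "f i \<in> \<alpha> i k" if "i \<in> {1..d}" for i
    unfolding f_def using k[OF that] by (simp add: some_in_eq)
  have "inj_on f {1..d}"
    by (rule inj_onI) (use f layered_disjoint in metis)
  moreover have "f ` {1..d} \<subseteq> A k"
    using f layered_stream_subset layered_subset by blast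
  ultimately have "card {1..d} \<le> card (A k)" using finite_A card_inj_on_le by blast
  then show ?thesis using card_A[of k] by simp
qed

end

text \<open>
  The vertices outside \<open>V\<close> are closed under successors, so neither the new stream nor the new pool
  vertices reach \<open>V\<close>. This is why the new stream can receive the last number and why nothing new
  lies between vertices of an old stream.
\<close>

lemma layered_extend:
  assumes lay: "layered d \<alpha> V" and d: "1 \<le> d" and V: "V k1 \<noteq> A k1"
  shows "\<exists>\<beta> W. layered (Suc d) \<beta> W \<and> \<beta> 1 = \<alpha> 1"
proof -
  define B where "B k = A k - V k" for k
  have closed: "u \<in> B (Suc k)" if "v \<in> B k" "u \<in> A (Suc k)" "N k v u > 0" for k v u
    using that layered_closed[OF lay] reach_edge[of v A k u N] unfolding B_def by blast
  have "is_stream A B" unfolding is_stream_def B_def by blast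
  moreover have "B k1 \<noteq> {}" using V layered_subset[OF lay] unfolding B_def by blast
  ultimately obtain \<gamma> s T where g: "mixing \<gamma> s" "\<And>k. \<gamma> k \<subseteq> T k" "\<And>k. T k \<subseteq> B k"
    "\<And>k v n w. v \<in> B k \<Longrightarrow> reach N A k v n w \<Longrightarrow> w \<in> T n \<Longrightarrow> v \<in> T k"
    "\<And>k a m p n b. a \<in> \<gamma> k \<Longrightarrow> reach N A k a m p \<Longrightarrow> reach N A m p n b \<Longrightarrow> b \<in> \<gamma> n \<Longrightarrow> p \<in> \<gamma> m"
    "\<And>y. \<not> tail_path N (\<lambda>k. T k - \<gamma> k) y"
    by (rule split_off_stream) (blast intro: closed, (rule that; assumption))
  define \<beta> where "\<beta> = \<alpha>(Suc d := \<gamma>)"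
  define W where "W k = V k \<union> T k" for k
  have old: "\<beta> i = \<alpha> i" if "i \<in> {1..d}" for i using that unfolding \<beta>_def by auto
  have new: "\<beta> (Suc d) = \<gamma>" unfolding \<beta>_def by simp
  have split: "i = Suc d \<or> i \<in> {1..d}" if "i \<in> {1..Suc d}" for i using that by auto
  have first: "\<beta> 1 = \<alpha> 1" using old d by simp
  have TV: "T k \<inter> V k = {}" "T k \<subseteq> A k" for k using g(3) unfolding B_def by blast+
  have oldV: "\<alpha> i k \<subseteq> V k" if "i \<in> {1..d}" for i k using layered_stream_subset[OF lay that] .
  have T_closed: "v \<in> V k \<union> T k" if "reach N A k v n w" "w \<in> T n" for k v n w
    using g(4)[OF _ that] reach_source[OF that(1)] unfolding B_def by blast
  have leave: "w \<notin> V n" if "reach N A k v n w" "v \<in> T k" for k v n w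
    using layered_closed[OF lay that(1)] that(2) TV by blast
  have "layered (Suc d) \<beta> W"
    unfolding layered_def
  proof (intro conjI allI ballI impI)
    show "W k \<subseteq> A k" for k using layered_subset[OF lay] TV unfolding W_def by blast
    show "v \<in> W k" if "reach N A k v n w" "w \<in> W n" for k v n w
      using that T_closed layered_closed[OF lay] unfolding W_def by blast
    show "\<exists>s. mixing (\<beta> i) s" if "i \<in> {1..Suc d}" for i
      using split[OF that] old new g(1) layered_mixing[OF lay] by metis
    show "\<beta> i k \<subseteq> W k" if "i \<in> {1..Suc d}" for i k
      using split[OF that] old[of i] new g(2) oldV[of i k] unfolding W_def by auto
    show "\<beta> i k \<inter> \<beta> j k = {}" if "i \<in> {1..Suc d}" "j \<in> {1..Suc d}" "i \<noteq> j" for i j k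
    proof -
      have "\<gamma> k \<inter> V k = {}" using g(2) TV by blast
      then show ?thesis
        using split[OF that(1)] split[OF that(2)] that(3) old[of i] old[of j] new
          oldV[of i k] oldV[of j k] layered_disjoint[OF lay, of i j _ k] by auto blast+
    qed
    show "i \<le> j" if "i \<in> {1..Suc d}" "j \<in> {1..Suc d}" "a \<in> \<beta> i k" "b \<in> \<beta> j n" "reach N A k a n b"
      for i j k a n b
    proof (cases "j = Suc d")
      case False
      then have j: "j \<in> {1..d}" "b \<in> \<alpha> j n" using split[OF that(2)] that(4) old by auto
      then have "i \<noteq> Suc d" using leave[OF that(5)] that(3) new g(2) oldV by blast
      then have "i \<in> {1..d}" "a \<in> \<alpha> i k" using split[OF that(1)] that(3) old by auto
      then show ?thesis using layered_ordered[OF lay] j that(5) by blast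
    qed (use that(1) in simp)
    show "p \<in> \<beta> i m" if "i \<in> {1..Suc d}" "a \<in> \<beta> i k" "reach N A k a m p" "reach N A m p n b"
      "b \<in> \<beta> i n" for i k a m p n b
      using split[OF that(1)]
    proof
      assume "i = Suc d"
      then show ?thesis using that g(5) new by metis
    next
      assume "i \<in> {1..d}"
      then show ?thesis using that old layered_convex[OF lay] by metis
    qed
    show "p \<in> \<beta> 1 k" if "reach N A k p n b" "b \<in> \<beta> 1 n" for k p n b
      using that layered_first[OF lay] first by simp
    show "\<not> tail_path N (\<lambda>k. W k - (\<Union>i\<in>{1..Suc d}. \<beta> i k)) y" for y
    proof
      assume "tail_path N (\<lambda>k. W k - (\<Union>i\<in>{1..Suc d}. \<beta> i k)) y"
      then obtain k where y: "\<And>i. i \<ge> k \<Longrightarrow>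
          y i \<in> W i - (\<Union>i'\<in>{1..Suc d}. \<beta> i' i) \<and> N i (y i) (y (Suc i)) > 0"
        unfolding tail_path_def by blast
      have "(\<Union>i\<in>{1..Suc d}. \<beta> i n) = (\<Union>i\<in>{1..d}. \<alpha> i n) \<union> \<gamma> n" for n
        using old new by (auto simp: atLeastAtMostSuc_conv)
      then have y': "y i \<in> W i" "y i \<notin> (\<Union>i'\<in>{1..d}. \<alpha> i' i)" "y i \<notin> \<gamma> i" if "i \<ge> k" for i
        using y[OF that] by auto
      have yA: "y i \<in> A i" if "i \<ge> k" for i
        using y'(1)[OF that] layered_subset[OF lay] TV unfolding W_def by blast
      show False
      proof (cases "\<exists>i\<ge>k. y i \<in> T i")
        case True
        then obtain i where i: "i \<ge> k" "y i \<in> T i" by blast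
        have "y j \<in> T j - \<gamma> j" if "j \<ge> i" for j
        proof -
          have "reach N A i (y i) j (y j)"
            using that i(1) y yA by (intro reach_along) auto
          then show ?thesis using leave i y'[of j] that unfolding W_def by auto
        qed
        then have "tail_path N (\<lambda>k. T k - \<gamma> k) y"
          unfolding tail_path_def using y i(1) by (intro exI[of _ i]) auto
        then show False using g(6) by blast
      next
        case False
        then have "tail_path N (\<lambda>k. V k - (\<Union>i\<in>{1..d}. \<alpha> i k)) y"
          unfolding tail_path_def using y y' unfolding W_def by (intro exI[of _ k]) auto
        then show False using layered_pool[OF lay] by blast
      qed
    qed
  qed
  then show ?thesis using first by blast
qed

text \<open>
  Among the families that begin with \<open>\<gamma>\<close>, one with the largest number of streams exhausts \<open>A\<close>,
  since otherwise it could be extended.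
\<close>

lemma layered_completion:
  assumes mix: "mixing \<gamma> s" and closed: "\<And>k v n w. reach N A k v n w \<Longrightarrow> w \<in> \<gamma> n \<Longrightarrow> v \<in> \<gamma> k"
  shows "\<exists>d \<alpha>. 1 \<le> d \<and> layered d \<alpha> A \<and> \<alpha> 1 = \<gamma>"
proof -
  define Q where "Q d \<longleftrightarrow> 1 \<le> d \<and> (\<exists>\<alpha> V. layered d \<alpha> V \<and> \<alpha> 1 = \<gamma>)" for d
  have "layered 1 (\<lambda>_. \<gamma>) \<gamma>"
    unfolding layered_def using mix mixing_subset[OF mix] closed by (auto simp: tail_path_def)
  then have "Q 1" unfolding Q_def by auto
  moreover have "\<forall>d. Q d \<longrightarrow> d \<le> L" unfolding Q_def using layered_number_le by blast
  ultimately have "\<exists>d. Q d \<and> (\<forall>d'. Q d' \<longrightarrow> d' \<le> d)" by (rule Nat.ex_has_greatest_nat)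
  then obtain d where "Q d" and max: "\<And>d'. Q d' \<Longrightarrow> d' \<le> d" by blast
  then obtain \<alpha> V where a: "1 \<le> d" "layered d \<alpha> V" "\<alpha> 1 = \<gamma>" unfolding Q_def by blast
  have "V k = A k" for k
  proof (rule ccontr)
    assume "V k \<noteq> A k"
    then have "Q (Suc d)" using layered_extend[OF a(2,1)] a(3) unfolding Q_def by auto
    then show False using max[of "Suc d"] by simp
  qed
  then have "V = A" by blast
  then show ?thesis using a by blast
qed

text \<open>
  Splitting off from the whole diagram leaves no pool: every vertex has ancestors at time \<open>0\<close>, so
  the stream starts there and contains all vertices with access to it.
\<close>

lemma closed_mixing_stream_exists:
  "\<exists>\<gamma> s. mixing \<gamma> s \<and> (\<forall>k v n w. reach N A k v n w \<longrightarrow> w \<in> \<gamma> n \<longrightarrow> v \<in> \<gamma> k)"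
proof -
  have "is_stream A A" unfolding is_stream_def by blast
  then obtain \<gamma> s T where g: "mixing \<gamma> s" "\<And>k. \<gamma> k \<subseteq> T k" "\<And>k. T k \<subseteq> A k"
    "\<And>k v n w. v \<in> A k \<Longrightarrow> reach N A k v n w \<Longrightarrow> w \<in> T n \<Longrightarrow> v \<in> T k"
    "\<And>k. k < s \<Longrightarrow> T k = {}" "\<And>k v u. u \<in> T s \<Longrightarrow> reach N A s u k v \<Longrightarrow> v \<in> T k \<Longrightarrow> v \<in> \<gamma> k"
    by (rule split_off_stream[OF _ nonempty_A]) blast+
  have T_closed: "v \<in> T k" if "reach N A k v n w" "w \<in> T n" for k v n w
    using g(4) that reach_source by metis
  have eq: "v \<in> \<gamma> k" if v: "v \<in> T k" for k v
  proof -
    obtain u where u: "reach N A 0 u k v" using ancestor_exists[of v k 0] g(3) v by blast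
    then have "u \<in> T 0" using T_closed v by blast
    moreover from this have "s = 0" using g(5)[of 0] by blast
    ultimately show ?thesis using g(6) u v by blast
  qed
  have "v \<in> \<gamma> k" if "reach N A k v n w" "w \<in> \<gamma> n" for k v n w
    using eq T_closed that g(2) by blast
  then show ?thesis using g(1) by blast
qed

text \<open>
  A reduced primitive stream may be enlarged, up to any time \<open>K\<close>, by all vertices that reach it
  at time \<open>K\<close>; so a maximal one contains all its predecessors.
\<close>

lemma maximal_closed:
  assumes max: "maximal_reduced_primitive A N \<alpha>"
    and vw: "reach N A k v n w" "w \<in> \<alpha> n"
  shows "v \<in> \<alpha> k"
proof -
  obtain s where mix: "mixing \<alpha> s"
    using max reduced_primitive_iff_mixing[of \<alpha>] unfolding maximal_reduced_primitive_def by blast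
  have sub: "\<alpha> i \<subseteq> A i" for i using mixing_subset[OF mix] .
  have "n \<ge> s" using mixing_start[OF mix vw(2)] .
  \<comment> \<open>Cut at the time at which \<open>v\<close> reaches \<open>\<alpha>\<close>, so that \<open>v\<close> itself is absorbed.\<close>
  define \<beta> where "\<beta> i = (if i \<le> n then {v. \<exists>w\<in>\<alpha> n. reach N A i v n w} else \<alpha> i)" for i
  have to_n: "\<exists>w\<in>\<alpha> n. reach N \<alpha> i u n w" if "u \<in> \<alpha> i" "i \<le> n" for u i
    using that(2,1)
  proof (induction i arbitrary: u rule: inc_induct)
    case (step i)
    then have "i \<ge> s" using mixing_start[OF mix] by blast
    then obtain u' where "u' \<in> \<alpha> (Suc i)" "N i u u' > 0"
      using mix step.prems unfolding mixing_def by blast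
    then show ?case using step reach_edge reach_trans by metis
  qed (blast intro: reach.refl)
  have le: "\<alpha> i \<subseteq> \<beta> i" for i
    using to_n reach_mono[of N \<alpha> i _ n _ A] sub unfolding \<beta>_def by (fastforce split: if_splits)
  have "reach N A n u n w \<longleftrightarrow> w = u \<and> u \<in> A n" for u w
    using reach_same_time[of N A n u w] reach_source[of N A n u n w] reach.refl[of u A n N] by blast
  then have at_n: "\<beta> n = \<alpha> n" unfolding \<beta>_def using sub by auto
  have after: "\<beta> i = \<alpha> i" if "i \<ge> n" for i
    using that at_n unfolding \<beta>_def by (cases "i = n") auto
  have subA: "\<beta> i \<subseteq> A i" for i
    using sub unfolding \<beta>_def by (auto dest: reach_source)
  have "mixing \<beta> 0"
    unfolding mixing_def
  proof (intro conjI allI impI ballI)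
    show "is_stream A \<beta>" unfolding is_stream_def using subA by blast
    have "\<beta> i \<noteq> {}" for i
    proof (cases "i \<le> n")
      case True
      obtain w where w: "w \<in> \<alpha> n" using mixing_nonempty[OF mix \<open>n \<ge> s\<close>] by blast
      then show ?thesis using ancestor_exists[of w n i] True sub unfolding \<beta>_def by auto
    next
      case False
      then show ?thesis using mixing_nonempty[OF mix, of i] \<open>n \<ge> s\<close> unfolding \<beta>_def by simp
    qed
    then show "starts_at \<beta> 0" unfolding starts_at_def by blast
  next
    fix i u assume u: "u \<in> \<beta> i"
    show "\<exists>u'\<in>\<beta> (Suc i). N i u u' > 0"
    proof (cases "i < n")
      case True
      then obtain w where "w \<in> \<alpha> n" "reach N A i u n w" using u unfolding \<beta>_def by auto
      then show ?thesis using reach_first_edge[of N A i u n w] True unfolding \<beta>_def by auto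
    next
      case False
      then have "u \<in> \<alpha> i" "i \<ge> s" using u after[of i] \<open>n \<ge> s\<close> by auto
      then show ?thesis using mix le unfolding mixing_def by blast
    qed
  next
    fix i u assume u: "u \<in> \<beta> (Suc i)"
    show "\<exists>u'\<in>\<beta> i. N i u' u > 0"
    proof (cases "i < n")
      case True
      then obtain w where w: "w \<in> \<alpha> n" "reach N A (Suc i) u n w" using u unfolding \<beta>_def by auto
      obtain u' where u': "u' \<in> A i" "N i u' u > 0" using pred_A subA u by blast
      then have "reach N A i u' n w" using w reach_edge[of u' A i u N] reach_trans reach_source by metis
      then show ?thesis using True u' w unfolding \<beta>_def by auto
    next
      case False
      then have "u \<in> \<alpha> (Suc i)" "i \<ge> s" using u after[of "Suc i"] \<open>n \<ge> s\<close> by auto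
      then show ?thesis using mix le unfolding mixing_def by blast
    qed
  next
    fix i :: nat
    obtain m where m: "\<And>j x y. j \<ge> m \<Longrightarrow> x \<in> \<alpha> (max i n) \<Longrightarrow> y \<in> \<alpha> j \<Longrightarrow> reach N \<alpha> (max i n) x j y"
      using mix \<open>n \<ge> s\<close> unfolding mixing_def by (metis max.coboundedI2)
    have "reach N \<beta> i u j y" if j: "j \<ge> max m n" and u: "u \<in> \<beta> i" and y: "y \<in> \<beta> j" for j u y
    proof -
      have y': "y \<in> \<alpha> j" using y j after[of j] by simp
      have "\<exists>x\<in>\<alpha> (max i n). reach N \<beta> i u (max i n) x"
      proof (cases "i \<le> n")
        case True
        then obtain w where w: "w \<in> \<alpha> n" "reach N A i u n w" using u unfolding \<beta>_def by auto
        have "reach N \<beta> i u n w"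
          using w(2) by (rule reach_restrict) (use w(1) reach_le in \<open>fastforce simp: \<beta>_def\<close>)
        then show ?thesis using w True by (auto simp: max_def)
      next
        case False
        then show ?thesis using u after[of i] by (auto simp: max_def intro: reach.refl)
      qed
      then show ?thesis
        using m[of j _ y] j y' reach_mono[of N \<alpha> "max i n" _ j y \<beta>] le reach_trans
        by (metis max.boundedE)
    qed
    then show "\<exists>m. \<forall>j\<ge>m. \<forall>x\<in>\<beta> i. \<forall>y\<in>\<beta> j. reach N \<beta> i x j y" by blast
  qed
  then have "\<beta> = \<alpha>"
    using max le reduced_primitive_iff_mixing[of \<beta>] unfolding maximal_reduced_primitive_def by blast
  moreover have "v \<in> \<beta> k" using vw reach_le[OF vw(1)] unfolding \<beta>_def by auto
  ultimately show ?thesis by simp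
qed

section \<open>Eventual uniqueness\<close>

text \<open>
  An infinite path cannot stay in the pool, visits streams in the order of their numbers, and by
  convexity does not leave the last stream that it visits.
\<close>

lemma path_enters_stream:
  assumes lay: "layered d \<alpha> A" and x: "tail_path N A x"
  shows "\<exists>i\<in>{1..d}. \<exists>K. \<forall>k\<ge>K. x k \<in> \<alpha> i k"
proof -
  obtain k0 where x: "\<And>i. i \<ge> k0 \<Longrightarrow> x i \<in> A i \<and> N i (x i) (x (Suc i)) > 0"
    using x unfolding tail_path_def by blast
  have along: "reach N A i (x i) j (x j)" if "k0 \<le> i" "i \<le> j" for i j
    using that x by (intro reach_along) auto
  have hit: "\<exists>k\<ge>m. \<exists>i\<in>{1..d}. x k \<in> \<alpha> i k" for m
  proof (rule ccontr)
    assume "\<not> ?thesis"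
    then have "tail_path N (\<lambda>k. A k - (\<Union>i\<in>{1..d}. \<alpha> i k)) x"
      unfolding tail_path_def using x by (intro exI[of _ "max m k0"]) auto
    then show False using layered_pool[OF lay] by blast
  qed
  define I where "I = {i\<in>{1..d}. \<exists>k\<ge>k0. x k \<in> \<alpha> i k}"
  have I: "finite I" "I \<noteq> {}" using hit[of k0] unfolding I_def by auto
  define i where "i = Max I"
  have i: "i \<in> {1..d}" "\<exists>k\<ge>k0. x k \<in> \<alpha> i k" using Max_in[OF I] unfolding i_def I_def by auto
  then obtain k where k: "k \<ge> k0" "x k \<in> \<alpha> i k" by blast
  have "x m \<in> \<alpha> i m" if m: "m \<ge> k" for m
  proof -
    obtain n j where n: "n \<ge> m" "j \<in> {1..d}" "x n \<in> \<alpha> j n" using hit by blast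
    have "j \<in> I" using n m k(1) unfolding I_def by (auto intro!: exI[of _ n])
    then have "j \<le> i" using I unfolding i_def by simp
    moreover have "i \<le> j"
      using layered_ordered[OF lay i(1) n(2) k(2) n(3)] along k(1) m n(1) by simp
    ultimately have "x n \<in> \<alpha> i n" using n(3) by simp
    then show ?thesis
      using layered_convex[OF lay i(1) k(2), of m "x m" n "x n"] along k(1) m n(1) by simp
  qed
  then show ?thesis using i(1) by blast
qed

text \<open>
  At late times every vertex of \<open>\<alpha> i\<close> lies between two vertices of one path in \<open>\<alpha> i\<close>; this path
  ends up in some \<open>\<alpha>' j\<close>, and \<open>\<alpha>' j\<close> is convex.
\<close>

lemma stream_eventually_in_stream:
  assumes lay: "layered d \<alpha> A" and lay': "layered d' \<alpha>' A" and i: "i \<in> {1..d}"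
  shows "\<exists>j\<in>{1..d'}. \<forall>\<^sub>F k in sequentially. \<alpha> i k \<subseteq> \<alpha>' j k"
proof -
  obtain s where mix: "mixing (\<alpha> i) s" using layered_mixing[OF lay i] ..
  obtain x where x: "\<And>k. k \<ge> s \<Longrightarrow> x k \<in> \<alpha> i k \<and> N k (x k) (x (Suc k)) > 0"
    using mixing_path[OF mix] by blast
  have "tail_path N A x" unfolding tail_path_def using x mixing_subset[OF mix] by blast
  then obtain j K where j: "j \<in> {1..d'}" and K: "\<And>k. k \<ge> K \<Longrightarrow> x k \<in> \<alpha>' j k"
    using path_enters_stream[OF lay'] by blast
  define k where "k = max K s"
  obtain M where M: "\<And>n v w. n \<ge> M \<Longrightarrow> v \<in> \<alpha> i k \<Longrightarrow> w \<in> \<alpha> i n \<Longrightarrow> reach N A k v n w"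
    using mixing_reach[OF mix, of k] unfolding k_def by (metis max.cobounded2)
  have "v \<in> \<alpha>' j n" if n: "n \<ge> max M k" and v: "v \<in> \<alpha> i n" for n v
  proof -
    have "n \<ge> s" using n unfolding k_def by simp
    then obtain m where m: "\<And>n' w. n' \<ge> m \<Longrightarrow> w \<in> \<alpha> i n' \<Longrightarrow> reach N A n v n' w"
      using mixing_reach[OF mix] v by metis
    define n' where "n' = max m k"
    have "reach N A n v n' (x n')" using m x unfolding n'_def k_def by simp
    moreover have "reach N A k (x k) n v" using M x n v unfolding k_def by simp
    moreover have "x k \<in> \<alpha>' j k" "x n' \<in> \<alpha>' j n'" using K unfolding n'_def k_def by simp_all
    ultimately show ?thesis using layered_convex[OF lay' j] by blast
  qed
  then have "\<forall>\<^sub>F n in sequentially. \<alpha> i n \<subseteq> \<alpha>' j n" unfolding eventually_sequentially by blast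
  then show ?thesis using j by blast
qed

text \<open>
  Eventual containment in both directions returns to the stream from which it started, as distinct
  streams of one family are disjoint. Hence it is a bijection and an eventual equality.
\<close>

lemma layered_eventually_unique:
  assumes lay: "layered d \<alpha> A" and lay': "layered d' \<alpha>' A"
  shows "d' = d \<and> (\<exists>\<sigma> K. bij_betw \<sigma> {1..d} {1..d} \<and> (\<forall>k\<ge>K. \<forall>i\<in>{1..d}. \<alpha>' i k = \<alpha> (\<sigma> i) k))"
proof -
  have same: "i = i'"
    if lay: "layered e \<beta> A" and i: "i \<in> {1..e}" and i': "i' \<in> {1..e}"
      and sub: "\<forall>\<^sub>F k in sequentially. \<beta> i k \<subseteq> \<beta>' k"
      and sub': "\<forall>\<^sub>F k in sequentially. \<beta>' k \<subseteq> \<beta> i' k" for e \<beta> \<beta>' i i'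
  proof -
    obtain s where "mixing (\<beta> i) s" using layered_mixing[OF lay i] ..
    then have "\<forall>\<^sub>F k in sequentially. \<beta> i k \<noteq> {}"
      using mixing_nonempty unfolding eventually_sequentially by blast
    then have "\<forall>\<^sub>F k in sequentially. \<beta> i k \<noteq> {} \<and> \<beta> i k \<subseteq> \<beta> i' k"
      using sub sub' by eventually_elim blast
    then obtain k v where "v \<in> \<beta> i k" "v \<in> \<beta> i' k" unfolding eventually_sequentially by blast
    then show ?thesis using layered_disjoint[OF lay i i'] by blast
  qed
  obtain f where f: "\<And>i. i \<in> {1..d} \<Longrightarrow> f i \<in> {1..d'}"
      "\<And>i. i \<in> {1..d} \<Longrightarrow> \<forall>\<^sub>F k in sequentially. \<alpha> i k \<subseteq> \<alpha>' (f i) k"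
    using stream_eventually_in_stream[OF lay lay'] by metis
  obtain g where g: "\<And>j. j \<in> {1..d'} \<Longrightarrow> g j \<in> {1..d}"
      "\<And>j. j \<in> {1..d'} \<Longrightarrow> \<forall>\<^sub>F k in sequentially. \<alpha>' j k \<subseteq> \<alpha> (g j) k"
    using stream_eventually_in_stream[OF lay' lay] by metis
  have gf: "g (f i) = i" if "i \<in> {1..d}" for i
    using same[OF lay that g(1) f(2) g(2)] f(1) that by metis
  have fg: "f (g j) = j" if "j \<in> {1..d'}" for j
    using same[OF lay' that f(1) g(2) f(2)] g(1) that by metis
  have bij: "bij_betw g {1..d'} {1..d}"
    by (rule bij_betw_byWitness[of _ f]) (use f(1) g(1) gf fg in blast)+
  then have "d' = d" using bij_betw_same_card by fastforce
  have "\<forall>\<^sub>F k in sequentially. \<alpha>' j k = \<alpha> (g j) k" if j: "j \<in> {1..d'}" for j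
    using g(2)[OF j] f(2)[OF g(1)[OF j]] unfolding fg[OF j] by eventually_elim blast
  then have "\<forall>\<^sub>F k in sequentially. \<forall>j\<in>{1..d'}. \<alpha>' j k = \<alpha> (g j) k"
    by (simp add: eventually_ball_finite)
  then show ?thesis using bij \<open>d' = d\<close> unfolding eventually_sequentially by blast
qed

section \<open>Stream decompositions\<close>

text \<open>
  Front-connections are paths, so everything is a matter of sorting out where a vertex \<open>p\<close> on a path
  can lie. Between two vertices of \<open>\<alpha> i\<close> it cannot be in the pool, by the case \<open>i = j\<close> of the pool
  condition, nor in another stream, by the order; ahead of \<open>\<alpha> 1\<close> it can only be in \<open>\<alpha> 1\<close>.
\<close>

lemma decomposition_imp_layered:
  assumes dec: "stream_decomposition A N d \<alpha> P"
  shows "1 \<le> d \<and> layered d \<alpha> A \<and> P = (\<lambda>k. A k - (\<Union>i\<in>{1..d}. \<alpha> i k))"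
proof -
  have mix: "\<exists>s. mixing (\<alpha> i) s" if "i \<in> {1..d}" for i
    using dec that reduced_primitive_iff_mixing unfolding stream_decomposition_def by blast
  have cover: "(\<Union>i\<in>{1..d}. \<alpha> i k) \<union> P k = A k" for k
    using dec unfolding stream_decomposition_def streams_partition_def by blast
  have disj: "i = j" if "i \<in> {1..d}" "j \<in> {1..d}" "v \<in> \<alpha> i k" "v \<in> \<alpha> j k" for i j k v
    using dec that unfolding stream_decomposition_def streams_partition_def by blast
  have disjP: "v \<notin> P k" if "i \<in> {1..d}" "v \<in> \<alpha> i k" for i k v
    using dec that unfolding stream_decomposition_def streams_partition_def by blast
  have ord: "i < j" if "i \<in> {1..d}" "j \<in> {1..d}" "i \<noteq> j" "front_connected A N (\<alpha> i) (\<alpha> j)" for i j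
    using dec that unfolding stream_decomposition_def streams_ordered_def by blast
  have pool_path: "\<not> (infinite_vertex_path A N k x \<and> (\<forall>i\<ge>k. x i \<in> P i))" for k x
    using dec unfolding stream_decomposition_def pool_condition_def by blast
  have pool_first: "\<not> front_connected A N (symbol_stream k p) (\<alpha> 1)" if "p \<in> P k" for k p
    using dec that unfolding stream_decomposition_def pool_condition_def by blast
  have pool_between: "i < j" if "p \<in> P k" "i \<in> {1..d}" "j \<in> {1..d}"
    "front_connected A N (\<alpha> i) (symbol_stream k p)" "front_connected A N (symbol_stream k p) (\<alpha> j)"
    for i j k p
    using dec that unfolding stream_decomposition_def pool_condition_def by blast
  have P: "P = (\<lambda>k. A k - (\<Union>i\<in>{1..d}. \<alpha> i k))" using cover disjP by fastforce
  have pool: "\<not> tail_path N (\<lambda>k. A k - (\<Union>i\<in>{1..d}. \<alpha> i k)) y" for y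
  proof
    assume "tail_path N (\<lambda>k. A k - (\<Union>i\<in>{1..d}. \<alpha> i k)) y"
    then obtain k where "\<forall>i\<ge>k. y i \<in> P i \<and> N i (y i) (y (Suc i)) > 0"
      unfolding P tail_path_def by blast
    then have "infinite_vertex_path A N k y \<and> (\<forall>i\<ge>k. y i \<in> P i)"
      unfolding infinite_vertex_path_def using P by blast
    then show False using pool_path by blast
  qed
  have "1 \<le> d"
  proof (rule ccontr)
    assume "\<not> 1 \<le> d"
    moreover obtain v where "v \<in> A 0" using nonempty_A by blast
    then obtain x where "\<forall>i\<ge>0. x i \<in> A i \<and> N i (x i) (x (Suc i)) > 0"
      using path_of_successors[of v A 0 N] succ_A by blast
    ultimately have "tail_path N (\<lambda>k. A k - (\<Union>i\<in>{1..d}. \<alpha> i k)) x"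
      unfolding tail_path_def by auto
    then show False using pool by blast
  qed
  have ordered: "i \<le> j" if "i \<in> {1..d}" "j \<in> {1..d}" "a \<in> \<alpha> i k" "b \<in> \<alpha> j n" "reach N A k a n b"
    for i j k a n b
  proof (cases "i = j")
    case False
    have "k \<noteq> n" using False that disj reach_same_time by metis
    then have "k < n" using reach_le[OF that(5)] by simp
    then have "front_connected A N (\<alpha> i) (\<alpha> j)"
      unfolding front_connected_iff_reach using that by blast
    then show ?thesis using ord[OF that(1,2) False] by simp
  qed simp
  have symbol: "p \<in> symbol_stream k p k" for p k unfolding symbol_stream_def by simp
  have to_pool: "front_connected A N (\<alpha> i) (symbol_stream m p)"
    if "i \<in> {1..d}" "a \<in> \<alpha> i k" "reach N A k a m p" "p \<in> P m" for i a k m p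
  proof -
    have "k \<noteq> m" using that disjP reach_same_time by metis
    then have "k < m" using reach_le[OF that(3)] by simp
    then show ?thesis
      unfolding front_connected_iff_reach using that(2,3) symbol[of p m] by (intro exI conjI)
  qed
  have from_pool: "front_connected A N (symbol_stream m p) (\<alpha> i)"
    if "i \<in> {1..d}" "b \<in> \<alpha> i n" "reach N A m p n b" "p \<in> P m" for i b n m p
  proof -
    have "m \<noteq> n" using that disjP reach_same_time by metis
    then have "m < n" using reach_le[OF that(3)] by simp
    then show ?thesis
      unfolding front_connected_iff_reach using that(2,3) symbol[of p m] by (intro exI conjI)
  qed
  have place: "p \<in> P k \<or> (\<exists>j\<in>{1..d}. p \<in> \<alpha> j k)" if "p \<in> A k" for k p using cover[of k] that by blast
  have convex: "p \<in> \<alpha> i m" if i: "i \<in> {1..d}" "a \<in> \<alpha> i k" "reach N A k a m p" "reach N A m p n b"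
      "b \<in> \<alpha> i n" for i k a m p n b
    using place[OF reach_target[OF that(3)]]
  proof
    assume "p \<in> P m"
    then show ?thesis using pool_between[of p m i i] to_pool from_pool that by blast
  next
    assume "\<exists>j\<in>{1..d}. p \<in> \<alpha> j m"
    then obtain j where "j \<in> {1..d}" "p \<in> \<alpha> j m" by blast
    then show ?thesis using ordered that by (metis order_antisym)
  qed
  have first: "p \<in> \<alpha> 1 k" if "reach N A k p n b" "b \<in> \<alpha> 1 n" for k p n b
    using place[OF reach_source[OF that(1)]]
  proof
    assume "p \<in> P k"
    then show ?thesis using pool_first from_pool that \<open>1 \<le> d\<close> by (metis atLeastAtMost_iff order_refl)
  next
    assume "\<exists>j\<in>{1..d}. p \<in> \<alpha> j k"
    then obtain j where j: "j \<in> {1..d}" "p \<in> \<alpha> j k" by blast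
    then have "j \<le> 1" using ordered[of j 1 p k b n] that \<open>1 \<le> d\<close> by simp
    then show ?thesis using j by (metis atLeastAtMost_iff order_antisym)
  qed
  have closedA: "\<forall>k v n w. reach N A k v n w \<longrightarrow> w \<in> A n \<longrightarrow> v \<in> A k" using reach_source by metis
  have "layered d \<alpha> A"
    unfolding layered_def
    using mix cover disj ordered convex pool first closedA by (intro conjI) blast+
  then show ?thesis using \<open>1 \<le> d\<close> P by blast
qed

text \<open>
  That every pool vertex \<open>p\<close> is connected to some stream is not built into \<open>layered\<close>: it holds
  because a path from \<open>p\<close> ends up in a stream, which is not \<open>\<alpha> 1\<close> because \<open>\<alpha> 1\<close> contains all its
  predecessors.
\<close>

lemma layered_imp_decomposition:
  assumes d: "1 \<le> d" and lay: "layered d \<alpha> A"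
  shows "stream_decomposition A N d \<alpha> (\<lambda>k. A k - (\<Union>i\<in>{1..d}. \<alpha> i k))"
proof -
  let ?P = "\<lambda>k. A k - (\<Union>i\<in>{1..d}. \<alpha> i k)"
  have rp: "reduced_stream A N (\<alpha> i) \<and> primitive_stream A N (\<alpha> i)" if "i \<in> {1..d}" for i
    using layered_mixing[OF lay that] reduced_primitive_iff_mixing by blast
  have "streams_partition A d \<alpha> ?P"
    unfolding streams_partition_def
  proof (intro conjI allI impI ballI)
    show "(\<Union>i\<in>{1..d}. \<alpha> i k) \<union> ?P k = A k" for k
      using layered_stream_subset[OF lay] by blast
    show "\<alpha> i k \<inter> \<alpha> j k = {}" if "i \<in> {1..d}" "j \<in> {1..d}" "i \<noteq> j" for i j k
      using layered_disjoint[OF lay that(1,2)] that(3) by blast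
    show "\<alpha> i k \<inter> ?P k = {}" if "i \<in> {1..d}" for i k using that by blast
    show "\<alpha> i k \<noteq> {}" if "Max ((\<lambda>i. start_time (\<alpha> i)) ` {1..d}) \<le> k" "i \<in> {1..d}" for i k
    proof -
      have "start_time (\<alpha> i) \<le> Max ((\<lambda>i. start_time (\<alpha> i)) ` {1..d})" using that(2) by simp
      then have "start_time (\<alpha> i) \<le> k" using that(1) by simp
      moreover have "starts_at (\<alpha> i) (start_time (\<alpha> i))"
        using rp[OF that(2)] starts_at_start_time unfolding reduced_stream_def by blast
      ultimately show ?thesis unfolding starts_at_def by blast
    qed
  qed
  moreover have "streams_ordered A N d \<alpha>"
    unfolding streams_ordered_def front_connected_iff_reach
    using layered_ordered[OF lay] by (metis le_neq_implies_less)
  moreover have "pool_condition A N d \<alpha> ?P"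
    unfolding pool_condition_def
  proof (intro conjI allI ballI impI)
    show "\<nexists>k x. infinite_vertex_path A N k x \<and> (\<forall>i\<ge>k. x i \<in> ?P i)"
    proof
      assume "\<exists>k x. infinite_vertex_path A N k x \<and> (\<forall>i\<ge>k. x i \<in> ?P i)"
      then obtain k x where "infinite_vertex_path A N k x" "\<forall>i\<ge>k. x i \<in> ?P i" by blast
      then have "\<forall>i\<ge>k. x i \<in> ?P i \<and> N i (x i) (x (Suc i)) > 0"
        unfolding infinite_vertex_path_def by blast
      then have "\<exists>k. \<forall>i\<ge>k. x i \<in> ?P i \<and> N i (x i) (x (Suc i)) > 0" ..
      then have "tail_path N ?P x" unfolding tail_path_def .
      then show False using layered_pool[OF lay] by simp
    qed
    fix k p assume p: "p \<in> ?P k"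
    show not_first: "\<not> front_connected A N (symbol_stream k p) (\<alpha> 1)"
    proof
      assume "front_connected A N (symbol_stream k p) (\<alpha> 1)"
      then obtain n b where "b \<in> \<alpha> 1 n" "reach N A k p n b"
        unfolding front_connected_iff_reach symbol_stream_def by (auto split: if_splits)
      then have "p \<in> \<alpha> 1 k" using layered_first[OF lay] by blast
      then show False using p d by auto
    qed
    show "\<exists>j\<in>{1..d}. 1 < j \<and> front_connected A N (symbol_stream k p) (\<alpha> j)"
    proof -
      obtain x where x: "x k = p" "\<And>i. i \<ge> k \<Longrightarrow> x i \<in> A i \<and> N i (x i) (x (Suc i)) > 0"
        using path_of_successors[of p A k N] succ_A p by blast
      then have "tail_path N A x" unfolding tail_path_def by blast
      then obtain j K where j: "j \<in> {1..d}" "\<And>n. n \<ge> K \<Longrightarrow> x n \<in> \<alpha> j n"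
        using path_enters_stream[OF lay] by blast
      define n where "n = max K (Suc k)"
      have "reach N A k p n (x n)"
        using reach_along[of k n x A N] x unfolding n_def by auto
      then have "front_connected A N (symbol_stream k p) (\<alpha> j)"
        unfolding front_connected_iff_reach symbol_stream_def
        using j(2)[of n] by (intro exI[of _ k] exI[of _ n]) (auto simp: n_def)
      moreover from this have "j \<noteq> 1" using not_first by blast
      ultimately show ?thesis using j(1) by (intro bexI[of _ j]) auto
    qed
    fix i j assume i: "i \<in> {1..d}" and j: "j \<in> {1..d}"
      and "front_connected A N (\<alpha> i) (symbol_stream k p) \<and>
           front_connected A N (symbol_stream k p) (\<alpha> j)"
    then obtain m a n b where ab: "a \<in> \<alpha> i m" "reach N A m a k p" "b \<in> \<alpha> j n" "reach N A k p n b"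
      unfolding front_connected_iff_reach symbol_stream_def by (auto split: if_splits)
    have "i \<le> j" using layered_ordered[OF lay i j ab(1,3)] reach_trans[OF ab(2,4)] by blast
    moreover have "i \<noteq> j" using layered_convex[OF lay i ab(1,2,4)] ab(3) i p by blast
    ultimately show "i < j" by simp
  qed
  ultimately show ?thesis
    unfolding stream_decomposition_def using rp by (simp add: is_stream_def)
qed

lemma decomposition_iff_layered:
  "stream_decomposition A N d \<alpha> P \<longleftrightarrow>
     1 \<le> d \<and> layered d \<alpha> A \<and> P = (\<lambda>k. A k - (\<Union>i\<in>{1..d}. \<alpha> i k))"
  using decomposition_imp_layered layered_imp_decomposition by blast

lemma decompositions_eventually_same:
  assumes dec: "stream_decomposition A N d \<alpha> P" and dec': "stream_decomposition A N d' \<alpha>' P'"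
  shows "eventually_same_decomposition A N d \<alpha> P d' \<alpha>' P'"
proof -
  have lay: "layered d \<alpha> A" "layered d' \<alpha>' A"
    and P: "P = (\<lambda>k. A k - (\<Union>i\<in>{1..d}. \<alpha> i k))" "P' = (\<lambda>k. A k - (\<Union>i\<in>{1..d'}. \<alpha>' i k))"
    using dec dec' unfolding decomposition_iff_layered by auto
  obtain \<sigma> K where d': "d' = d" and \<sigma>: "bij_betw \<sigma> {1..d} {1..d}"
    and eq: "\<And>k i. k \<ge> K \<Longrightarrow> i \<in> {1..d} \<Longrightarrow> \<alpha>' i k = \<alpha> (\<sigma> i) k"
    using layered_eventually_unique[OF lay] by blast
  have "P' k = P k" if "k \<ge> K" for k
  proof -
    have "(\<Union>i\<in>{1..d}. \<alpha>' i k) = (\<Union>i\<in>{1..d}. \<alpha> (\<sigma> i) k)" using eq[OF that] by simp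
    also have "\<dots> = (\<Union>i\<in>\<sigma> ` {1..d}. \<alpha> i k)" by simp
    also have "\<sigma> ` {1..d} = {1..d}" using \<sigma> by (rule bij_betw_imp_surj_on)
    finally show ?thesis unfolding P d' by simp
  qed
  moreover have "streams_ordered A N d (\<lambda>i. stream_from K (\<alpha> (\<sigma> i)))"
    unfolding streams_ordered_def
  proof (intro ballI impI)
    fix i j assume i: "i \<in> {1..d}" and j: "j \<in> {1..d}" and "i \<noteq> j"
      and "front_connected A N (stream_from K (\<alpha> (\<sigma> i))) (stream_from K (\<alpha> (\<sigma> j)))"
    then obtain k n a b where kn: "k < n" "K \<le> k" and "a \<in> \<alpha> (\<sigma> i) k" "b \<in> \<alpha> (\<sigma> j) n"
      and ab: "reach N A k a n b"
      unfolding front_connected_iff_reach stream_from_def by (auto split: if_splits)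
    then have "a \<in> \<alpha>' i k" "b \<in> \<alpha>' j n" using eq[of k i] eq[of n j] i j by auto
    then have "i \<le> j" using layered_ordered[OF lay(2)] i j ab unfolding d' by blast
    then show "i < j" using \<open>i \<noteq> j\<close> by simp
  qed
  ultimately show ?thesis
    unfolding eventually_same_decomposition_def using d' \<sigma> eq by blast
qed

end

section \<open>The stream decomposition theorem\<close>

theorem theorem3p9:
  fixes A :: "nat \<Rightarrow> 'a set" and l :: "nat \<Rightarrow> nat" and N :: "nat \<Rightarrow> 'a \<Rightarrow> 'a \<Rightarrow> real"
  assumes "\<forall>i. finite (A i) \<and> card (A i) = l i \<and> l i > 0"
    and "bdd_above (range l)"
    and "\<forall>i. \<forall>x\<in>A i. \<forall>y\<in>A (Suc i). N i x y \<ge> 0"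
    and "reduced_seq A N 0"
  shows "(\<exists>d \<alpha> P. stream_decomposition A N d \<alpha> P) \<and>
    (\<forall>d \<alpha> P d' \<alpha>' P'. stream_decomposition A N d \<alpha> P \<and> stream_decomposition A N d' \<alpha>' P' \<longrightarrow>
       eventually_same_decomposition A N d \<alpha> P d' \<alpha>' P') \<and>
    (\<forall>\<alpha>. maximal_reduced_primitive A N \<alpha> \<longrightarrow>
       (\<exists>d \<beta> P. stream_decomposition A N d \<beta> P \<and> (\<exists>i\<in>{1..d}. \<beta> i = \<alpha>)))"
proof -
  obtain L where L: "\<And>i. l i \<le> L" using assms(2) unfolding bdd_above_def by blast
  interpret reduced_diagram A N L
  proof
    show "finite (A k)" "card (A k) \<le> L" for k using assms(1) L by auto
    show "A k \<noteq> {}" for k using assms(1) by (metis card.empty less_irrefl)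
    show "N k x y \<ge> 0" if "x \<in> A k" "y \<in> A (Suc k)" for k x y using assms(3) that by blast
    show "\<exists>y\<in>A (Suc k). N k x y > 0" if "x \<in> A k" for k x
      using assms(3,4) that unfolding reduced_seq_def by (metis less_eq_real_def zero_le)
    show "\<exists>x\<in>A k. N k x y > 0" if "y \<in> A (Suc k)" for k y
      using assms(3,4) that unfolding reduced_seq_def by (metis less_eq_real_def zero_le)
  qed
  have "\<exists>d \<alpha> P. stream_decomposition A N d \<alpha> P"
    using closed_mixing_stream_exists layered_completion layered_imp_decomposition by metis
  moreover have "\<exists>d \<beta> P. stream_decomposition A N d \<beta> P \<and> (\<exists>i\<in>{1..d}. \<beta> i = \<alpha>)"
    if max: "maximal_reduced_primitive A N \<alpha>" for \<alpha>
  proof -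
    obtain s where "mixing \<alpha> s"
      using max reduced_primitive_iff_mixing unfolding maximal_reduced_primitive_def by blast
    then obtain d \<beta> where "1 \<le> d" "layered d \<beta> A" "\<beta> 1 = \<alpha>"
      using layered_completion maximal_closed[OF max] by blast
    moreover from this have "1 \<in> {1..d}" by simp
    ultimately show ?thesis using layered_imp_decomposition by blast
  qed
  ultimately show ?thesis using decompositions_eventually_same by blast
qed

end
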